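(* Let $\mathsf E:\mathcal A\to\mathcal L(\mathcal H)$ be a POVM and $f:\Omega\to\mathbb C$ a positive (i.e. $f\ge0$) $\mathcal A$-measurable function such that $\mathcal D_F(f,\mathsf E)$ is dense in $\mathcal H$. Then the quadratic form $$F_{f,\mathsf E}:\mathcal D_F(f,\mathsf E)\times\mathcal D_F(f,\mathsf E)\to\mathbb C,\qquad F_{f,\mathsf E}(\psi,\varphi)=\int f\,d\mathsf E_{\psi,\varphi},$$ is symmetric, positive and closed. The positive selfadjoint operator $T$ associated to $F_{f,\mathsf E}$ is given by $$T=\big(L(\sqrt f,\mathsf F)V\big)^*L(\sqrt f,\mathsf F)V,$$ where $(\mathcal K,\mathsf F,V)$ is any Naimark dilation of $\mathsf E$. Moreover, $$T=L'(f,\mathsf E),$$ i.e. $T$ is the largest symmetric weak operator integral determined by $f$ and $\mathsf E$. In particular, $L'(f,\mathsf E)$ is selfadjoint.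
   Context: $(\Omega,\mathcal A)$ is a measurable space, $\mathcal H$ a complex Hilbert space with inner product linear in the second argument, $\mathcal L(\mathcal H)$ the bounded operators. A POVM is a strongly $\sigma$-additive map $\mathsf E:\mathcal A\to\mathcal L(\mathcal H)$ with $\mathsf E(X)\ge0$ for all $X$. $\mathsf E_{\psi,\varphi}$ is the complex measure $X\mapsto\langle\psi|\mathsf E(X)\varphi\rangle$. A Naimark dilation $(\mathcal K,\mathsf F,V)$ of $\mathsf E$ consists of a Hilbert space $\mathcal K$, a spectral measure (normalized projection valued POVM) $\mathsf F:\mathcal A\to\mathcal L(\mathcal K)$, and a bounded linear map $V:\mathcal H\to\mathcal K$ with $\mathsf E(X)=V^*\mathsf F(X)V$ for all $X\in\mathcal A$. $L(\sqrt f,\mathsf F)$ is the usual spectral integral $\int\sqrt f\,d\mathsf F$, with domain $\{\xi\in\mathcal K:\int f\,d\mathsf F_{\xi,\xi}<\infty\}$. Products of operators have their natural domains. $\mathcal D_F(f,\mathsf E)=\{\varphi\in\mathcal H:\int|f|\,d\mathsf E_{\varphi,\varphi}<\infty\}$ is a linear subspace and $f$ is $\mathsf E_{\psi,\varphi}$-integrable for all $\psi,\varphi$ in it. When it is dense, $L'(f,\mathsf E)$ is the linear operator with domain $\{\varphi\in\mathcal D_F(f,\mathsf E):\mathcal D_F(f,\mathsf E)\ni\psi\mapsto\int f\,d\mathsf E_{\psi,\varphi}\text{ is (norm) continuous}\}$ determined by $\langle\psi|L'(f,\mathsf E)\varphi\rangle=\int f\,d\mathsf E_{\psi,\varphi}$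 for all $\psi\in\mathcal D_F(f,\mathsf E)$. A quadratic form is a sesquilinear form $q:\mathcal D\times\mathcal D\to\mathbb C$ on a dense subspace $\mathcal D$ of $\mathcal H$. It is symmetric if $q(\psi,\varphi)=\overline{q(\varphi,\psi)}$, positive if $q(\varphi,\varphi)\ge0$; a positive $q$ is closed if $\varphi_n\in\mathcal D$, $\varphi_n\to\varphi\in\mathcal H$ and $\lim_{n,m}q(\varphi_n-\varphi_m,\varphi_n-\varphi_m)=0$ imply $\varphi\in\mathcal D$ and $\lim_nq(\varphi_n-\varphi,\varphi_n-\varphi)=0$. The operator associated to a closed symmetric positive form $q$ with dense domain $\mathcal D$ is the unique positive selfadjoint $T$ with $\mathrm{Dom}(\sqrt T)=\mathcal D$ and $q(\psi,\varphi)=\langle\sqrt T\psi|\sqrt T\varphi\rangle$ for all $\psi,\varphi\in\mathcal D$. *)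

theory Defs
  imports "HOL-Analysis.Analysis"
begin

class complex_inner = real_normed_vector +
  fixes scaleC :: "complex \<Rightarrow> 'a \<Rightarrow> 'a" (infixr "*\<^sub>C" 75)
    and cinner :: "'a \<Rightarrow> 'a \<Rightarrow> complex"
  assumes scaleC_add_right: "c *\<^sub>C (x + y) = c *\<^sub>C x + c *\<^sub>C y"
    and scaleC_add_left: "(c + d) *\<^sub>C x = c *\<^sub>C x + d *\<^sub>C x"
    and scaleC_scaleC: "c *\<^sub>C d *\<^sub>C x = (c * d) *\<^sub>C x"
    and scaleR_scaleC: "r *\<^sub>R x = complex_of_real r *\<^sub>C x"
    and cinner_commute: "cinner x y = cnj (cinner y x)"
    and cinner_add_right: "cinner x (y + z) = cinner x y + cinner x z"
    and cinner_scaleC_right: "cinner x (c *\<^sub>C y) = c * cinner x y"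
    and cinner_ge_zero: "0 \<le> Re (cinner x x)"
    and norm_eq_sqrt_cinner: "norm x = sqrt (Re (cinner x x))"

class chilbert_space = complex_inner + complete_space

global_interpretation complex_vector: vector_space "scaleC :: complex \<Rightarrow> 'a \<Rightarrow> 'a::complex_inner"
proof
  show "(1::complex) *\<^sub>C x = x" for x :: 'a
    by (metis of_real_1 scaleR_one scaleR_scaleC)
qed (simp_all add: scaleC_add_right scaleC_add_left scaleC_scaleC)

instantiation complex :: chilbert_space
begin

definition "scaleC (c::complex) (x::complex) = c * x"
definition "cinner (x::complex) (y::complex) = cnj x * y"

instance
  by standard
    (auto simp: scaleC_complex_def cinner_complex_def algebra_simps scaleR_conv_of_real
      cmod_def power2_eq_square)

end

definition bounded_clinear :: "('a::complex_inner \<Rightarrow> 'b::complex_inner) \<Rightarrow> bool" where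
  "bounded_clinear T \<longleftrightarrow> bounded_linear T \<and> (\<forall>c x. T (c *\<^sub>C x) = c *\<^sub>C T x)"

text \<open>A not necessarily everywhere defined operator is a partial function with domain
  \<^term>\<open>dom T\<close>; the composition \<^term>\<open>S \<circ>\<^sub>m T\<close> then has
  the natural domain of a product of operators, and equality of operators includes equality of
  the domains.\<close>

definition everywhere :: "('a \<Rightarrow> 'b) \<Rightarrow> 'a \<rightharpoonup> 'b" where
  "everywhere T = (\<lambda>x. Some (T x))"

definition linear_operator :: "('a::complex_inner \<rightharpoonup> 'b::complex_inner) \<Rightarrow> bool" where
  "linear_operator T \<longleftrightarrow> complex_vector.subspace (dom T) \<and>
     (\<forall>x\<in>dom T. \<forall>y\<in>dom T. the (T (x + y)) = the (T x) + the (T y)) \<and>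
     (\<forall>c. \<forall>x\<in>dom T. the (T (c *\<^sub>C x)) = c *\<^sub>C the (T x))"

text \<open>Meaningful for densely defined operators only: density makes the described vector unique.\<close>

definition adjoint_operator :: "('a::complex_inner \<rightharpoonup> 'b::complex_inner) \<Rightarrow> 'b \<rightharpoonup> 'a" where
  "adjoint_operator T = (\<lambda>y.
     if \<exists>z. \<forall>x\<in>dom T. cinner y (the (T x)) = cinner z x
     then Some (THE z. \<forall>x\<in>dom T. cinner y (the (T x)) = cinner z x) else None)"

definition selfadjoint_operator :: "('a::complex_inner \<rightharpoonup> 'a) \<Rightarrow> bool" where
  "selfadjoint_operator T \<longleftrightarrow>
     linear_operator T \<and> closure (dom T) = UNIV \<and> adjoint_operator T = T"

definition positive_operator :: "('a::complex_inner \<rightharpoonup> 'a) \<Rightarrow> bool" where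
  "positive_operator T \<longleftrightarrow> (\<forall>x\<in>dom T. cinner x (the (T x)) \<in> \<real>\<^sub>\<ge>\<^sub>0)"

text \<open>The square root of a positive selfadjoint operator is characterized as its unique positive
  selfadjoint root; uniqueness makes the existential quantifier over roots in
  \<open>form_operator\<close> below a way of naming that root.\<close>

definition is_sqrt_operator :: "('a::complex_inner \<rightharpoonup> 'a) \<Rightarrow> ('a \<rightharpoonup> 'a) \<Rightarrow> bool" where
  "is_sqrt_operator S T \<longleftrightarrow> selfadjoint_operator S \<and> positive_operator S \<and> S \<circ>\<^sub>m S = T"

text \<open>Only the values of \<^term>\<open>q\<close> on \<^term>\<open>D \<times> D\<close> are relevant.\<close>

definition quadratic_form :: "'a::complex_inner set \<Rightarrow> ('a \<Rightarrow> 'a \<Rightarrow> complex) \<Rightarrow> bool" where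
  "quadratic_form D q \<longleftrightarrow> complex_vector.subspace D \<and> closure D = UNIV \<and>
     (\<forall>x\<in>D. \<forall>y\<in>D. \<forall>z\<in>D. q x (y + z) = q x y + q x z \<and> q (x + y) z = q x z + q y z) \<and>
     (\<forall>c. \<forall>x\<in>D. \<forall>y\<in>D. q x (c *\<^sub>C y) = c * q x y \<and> q (c *\<^sub>C x) y = cnj c * q x y)"

definition symmetric_form :: "'a set \<Rightarrow> ('a \<Rightarrow> 'a \<Rightarrow> complex) \<Rightarrow> bool" where
  "symmetric_form D q \<longleftrightarrow> (\<forall>x\<in>D. \<forall>y\<in>D. q x y = cnj (q y x))"

definition positive_form :: "'a set \<Rightarrow> ('a \<Rightarrow> 'a \<Rightarrow> complex) \<Rightarrow> bool" where
  "positive_form D q \<longleftrightarrow> (\<forall>x\<in>D. q x x \<in> \<real>\<^sub>\<ge>\<^sub>0)"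

definition closed_form :: "'a::complex_inner set \<Rightarrow> ('a \<Rightarrow> 'a \<Rightarrow> complex) \<Rightarrow> bool" where
  "closed_form D q \<longleftrightarrow> (\<forall>s x. (\<forall>n. s n \<in> D) \<longrightarrow> s \<longlonglongrightarrow> x \<longrightarrow>
     ((\<lambda>(n, m). q (s n - s m) (s n - s m)) \<longlongrightarrow> 0) (sequentially \<times>\<^sub>F sequentially) \<longrightarrow>
     x \<in> D \<and> (\<lambda>n. q (s n - x) (s n - x)) \<longlonglongrightarrow> 0)"

definition form_operator ::
  "'a::complex_inner set \<Rightarrow> ('a \<Rightarrow> 'a \<Rightarrow> complex) \<Rightarrow> ('a \<rightharpoonup> 'a) \<Rightarrow> bool" where
  "form_operator D q T \<longleftrightarrow> selfadjoint_operator T \<and> positive_operator T \<and>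
     (\<exists>S. is_sqrt_operator S T \<and> dom S = D \<and>
       (\<forall>x\<in>D. \<forall>y\<in>D. q x y = cinner (the (S x)) (the (S y))))"

text \<open>Of a measure \<^term>\<open>M\<close> only the measurable space is used. For a finite signed measure
  \<^term>\<open>\<nu>\<close>, the following is the positive part of its Jordan decomposition, and the positive
  part of \<^term>\<open>\<lambda>X. - \<nu> X\<close> is the negative part; \<^term>\<open>ennreal\<close> sends
  negative reals to zero, which is harmless as the empty set takes part in the supremum.\<close>

definition positive_variation :: "'w measure \<Rightarrow> ('w set \<Rightarrow> real) \<Rightarrow> 'w measure" where
  "positive_variation M \<nu> =
     measure_of (space M) (sets M) (\<lambda>X. SUP Y\<in>{Y \<in> sets M. Y \<subseteq> X}. ennreal (\<nu> Y))"

definition cmeasure_integral ::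
  "'w measure \<Rightarrow> ('w set \<Rightarrow> complex) \<Rightarrow> ('w \<Rightarrow> complex) \<Rightarrow> complex" where
  "cmeasure_integral M \<mu> g =
     ((LINT w|positive_variation M (\<lambda>X. Re (\<mu> X)). g w)
       - (LINT w|positive_variation M (\<lambda>X. - Re (\<mu> X)). g w))
     + \<i> * ((LINT w|positive_variation M (\<lambda>X. Im (\<mu> X)). g w)
       - (LINT w|positive_variation M (\<lambda>X. - Im (\<mu> X)). g w))"

text \<open>Strong additivity along the constantly empty sequence forces \<^term>\<open>E {} = (\<lambda>x. 0)\<close>, so
  finite additivity is covered.\<close>

definition povm :: "'w measure \<Rightarrow> ('w set \<Rightarrow> 'h::complex_inner \<Rightarrow> 'h) \<Rightarrow> bool" where
  "povm M E \<longleftrightarrow>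
     (\<forall>X\<in>sets M. bounded_clinear (E X) \<and> (\<forall>x. cinner x (E X x) \<in> \<real>\<^sub>\<ge>\<^sub>0)) \<and>
     (\<forall>A. range A \<subseteq> sets M \<longrightarrow> disjoint_family A \<longrightarrow>
       (\<forall>x. (\<lambda>n::nat. E (A n) x) sums E (\<Union>n. A n) x))"

definition spectral_measure :: "'w measure \<Rightarrow> ('w set \<Rightarrow> 'k::complex_inner \<Rightarrow> 'k) \<Rightarrow> bool" where
  "spectral_measure M F \<longleftrightarrow> povm M F \<and> F (space M) = id \<and>
     (\<forall>X\<in>sets M. F X \<circ> F X = F X \<and> (\<forall>x y. cinner (F X x) y = cinner x (F X y)))"

definition naimark_dilation ::
  "'w measure \<Rightarrow> ('w set \<Rightarrow> 'h::complex_inner \<Rightarrow> 'h) \<Rightarrow>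
     ('w set \<Rightarrow> 'k::complex_inner \<Rightarrow> 'k) \<Rightarrow> ('h \<Rightarrow> 'k) \<Rightarrow> bool" where
  "naimark_dilation M E F V \<longleftrightarrow> spectral_measure M F \<and> bounded_clinear V \<and>
     (\<forall>X\<in>sets M. everywhere (E X) =
        adjoint_operator (everywhere V) \<circ>\<^sub>m everywhere (F X) \<circ>\<^sub>m everywhere V)"

definition diagonal_measure ::
  "'w measure \<Rightarrow> ('w set \<Rightarrow> 'h::complex_inner \<Rightarrow> 'h) \<Rightarrow> 'h \<Rightarrow> 'w measure" where
  "diagonal_measure M E x = measure_of (space M) (sets M) (\<lambda>X. ennreal (Re (cinner x (E X x))))"

definition form_domain ::
  "'w measure \<Rightarrow> ('w \<Rightarrow> complex) \<Rightarrow> ('w set \<Rightarrow> 'h::complex_inner \<Rightarrow> 'h) \<Rightarrow> 'h set" where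
  "form_domain M f E = {x. (\<integral>\<^sup>+w. ennreal (cmod (f w)) \<partial>diagonal_measure M E x) < \<infinity>}"

definition integral_form ::
  "'w measure \<Rightarrow> ('w \<Rightarrow> complex) \<Rightarrow> ('w set \<Rightarrow> 'h::complex_inner \<Rightarrow> 'h) \<Rightarrow> 'h \<Rightarrow> 'h \<Rightarrow> complex" where
  "integral_form M f E x y = cmeasure_integral M (\<lambda>X. cinner x (E X y)) f"

text \<open>The descriptions below determine the vector uniquely: in the first one \<^term>\<open>y\<close> ranges
  over the whole space, in the second one over a subspace that is assumed to be dense.\<close>

definition spectral_integral ::
  "'w measure \<Rightarrow> ('w \<Rightarrow> complex) \<Rightarrow> ('w set \<Rightarrow> 'k::complex_inner \<Rightarrow> 'k) \<Rightarrow> 'k \<rightharpoonup> 'k" where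
  "spectral_integral M g F = (\<lambda>x.
     if (\<integral>\<^sup>+w. ennreal ((cmod (g w))\<^sup>2) \<partial>diagonal_measure M F x) < \<infinity>
     then Some (THE z. \<forall>y. cinner y z = integral_form M g F y x) else None)"

definition weak_integral ::
  "'w measure \<Rightarrow> ('w \<Rightarrow> complex) \<Rightarrow> ('w set \<Rightarrow> 'h::complex_inner \<Rightarrow> 'h) \<Rightarrow> 'h \<rightharpoonup> 'h" where
  "weak_integral M f E = (\<lambda>x.
     if x \<in> form_domain M f E \<and>
        continuous_on (form_domain M f E) (\<lambda>y. integral_form M f E y x)
     then Some (THE z. \<forall>y\<in>form_domain M f E. cinner y z = integral_form M f E y x) else None)"

end

theory Submission
  imports Defs
begin

text \<open>Let \<open>D\<close> be the domain of the form \<open>q\<close>, \<open>q x y = \<integral> f dE\<^bsub>x,y\<^esub>\<close>, and let \<open>t\<^sub>n\<close> be simple functions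
  that increase to \<open>f\<close>. The operators \<open>G\<^sub>n = \<integral> t\<^sub>n dE\<close> are finite sums, hence bounded and positive, and
  \<open>q x y\<close> is the limit of \<open>\<langle>x|G\<^sub>n y\<rangle>\<close> on \<open>D\<close> (\<open>form_limit\<close>). Sesquilinearity, symmetry and positivity pass to
  the limit. On the diagonal the limit is a supremum of continuous functions, so it is lower
  semicontinuous, and \<open>q\<close> is closed (locale \<open>increasing_forms\<close>). The only analytic point is that \<open>f\<close>
  is integrable over the Jordan parts of \<open>E\<^bsub>x,y\<^esub>\<close>: by the Cauchy-Schwarz inequality these parts are dominated
  by the diagonal measures of \<open>x\<close> and \<open>y\<close> (\<open>positive_variation_integral_bound\<close>).

  All operators in the theorem are the operator \<open>form_op D q\<close>, which sends \<open>x\<close> to the vector \<open>z\<close> with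
  \<open>q x y = \<langle>z|y\<rangle>\<close> for all \<open>y\<close> in \<open>D\<close>. If \<open>A\<close> is any operator with domain \<open>D\<close> and \<open>q x y = \<langle>A x|A y\<rangle>\<close>, then
  \<open>A\<^sup>*A\<close> has literally this description (\<open>adjoint_comp_self\<close>). This applies to a root \<open>A = A\<^sup>*\<close> of an
  operator associated to the form, which gives uniqueness, and to \<open>A = L(\<surd>f, F) V\<close> for a dilation. For
  the weak integral it is the Riesz representation theorem that turns continuity of \<open>y \<mapsto> q y x\<close> into
  the existence of \<open>z\<close>.

  It remains to find a selfadjoint root of \<open>T = form_op D q\<close> with domain \<open>D\<close>, for an arbitrary closed
  positive form (locale \<open>closed_hermitian_form\<close>). The domain is complete in the inner product
  \<open>\<langle>x|y\<rangle> + q x y\<close>, and the Riesz representation theorem there yields the bounded operator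
  \<open>B = (1 + T)\<^sup>-\<^sup>1\<close> (\<open>resolvent\<close>), from which selfadjointness of \<open>T\<close> can be read off. Bounded
  positive operators have square roots by an elementary iteration (\<open>positive_sqrt\<close>), and
  \<open>\<surd>T\<close> is \<open>\<surd>(1 - B) (\<surd>B)\<^sup>-\<^sup>1\<close> (\<open>form_sqrt\<close>).\<close>

section \<open>Complex inner product spaces\<close>

lemma cinner_add_left: "cinner (x + y) z = cinner x z + cinner y (z::'a::complex_inner)"
  by (metis cinner_add_right cinner_commute complex_cnj_add)

lemma cinner_scaleC_left: "cinner (c *\<^sub>C x) y = cnj c * cinner x (y::'a::complex_inner)"
  by (metis cinner_commute cinner_scaleC_right complex_cnj_mult)

lemma scaleC_neg_one: "(-1) *\<^sub>C x = - (x::'a::complex_inner)"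
  using complex_vector.scale_minus_left[of 1 x] by simp

lemma cinner_scaleR_left: "cinner (r *\<^sub>R x) y = of_real r * cinner x (y::'a::complex_inner)"
  by (simp add: scaleR_scaleC cinner_scaleC_left)

lemma cinner_scaleR_right: "cinner x (r *\<^sub>R y) = of_real r * cinner x (y::'a::complex_inner)"
  by (simp add: scaleR_scaleC cinner_scaleC_right)

lemma cinner_minus_left: "cinner (- x) y = - cinner x (y::'a::complex_inner)"
  using cinner_scaleC_left[of "-1" x y] by (simp add: scaleC_neg_one)

lemma cinner_minus_right: "cinner x (- y) = - cinner x (y::'a::complex_inner)"
  using cinner_scaleC_right[of x "-1" y] by (simp add: scaleC_neg_one)

lemma cinner_diff_left: "cinner (x - y) z = cinner x z - cinner y (z::'a::complex_inner)"
  using cinner_add_left[of x "- y" z] by (simp add: cinner_minus_left)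

lemma cinner_diff_right: "cinner x (y - z) = cinner x y - cinner x (z::'a::complex_inner)"
  using cinner_add_right[of x y "- z"] by (simp add: cinner_minus_right)

lemma cinner_zero_left [simp]: "cinner 0 (y::'a::complex_inner) = 0"
  using cinner_diff_left[of 0 0 y] by simp

lemma cinner_zero_right [simp]: "cinner (y::'a::complex_inner) 0 = 0"
  using cinner_diff_right[of y 0 0] by simp

lemmas cinner_simps = cinner_add_left cinner_add_right cinner_diff_left cinner_diff_right
  cinner_minus_left cinner_minus_right cinner_scaleC_left cinner_scaleC_right
  cinner_scaleR_left cinner_scaleR_right

lemma cinner_self: "cinner x x = of_real ((norm (x::'a::complex_inner))\<^sup>2)"
proof -
  have "Im (cinner x x) = 0"
    using arg_cong[OF cinner_commute[of x x], of Im] by simp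
  then show ?thesis
    using cinner_ge_zero[of x] by (simp add: norm_eq_sqrt_cinner complex_eq_iff)
qed

lemma cinner_sum_left: "cinner (\<Sum>i\<in>A. u i) y = (\<Sum>i\<in>A. cinner (u i) (y::'a::complex_inner))"
  by (induction A rule: infinite_finite_induct) (auto simp: cinner_add_left)

lemma cinner_sum_right: "cinner y (\<Sum>i\<in>A. u i) = (\<Sum>i\<in>A. cinner (y::'a::complex_inner) (u i))"
  by (induction A rule: infinite_finite_induct) (auto simp: cinner_add_right)

section \<open>Positive hermitian forms\<close>

text \<open>The form lives on a subspace, not on a type, because the same algebra is applied to the inner product,
  to an unbounded form, to its graph inner product, and to \<open>\<langle>x|G y\<rangle>\<close> for a bounded positive
  operator \<open>G\<close>.\<close>

locale hermitian_form =
  fixes D :: "'a::complex_inner set" and p :: "'a \<Rightarrow> 'a \<Rightarrow> complex"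
  assumes subspace: "complex_vector.subspace D"
    and add_right: "\<And>x y z. x \<in> D \<Longrightarrow> y \<in> D \<Longrightarrow> z \<in> D \<Longrightarrow> p x (y + z) = p x y + p x z"
    and scale_right: "\<And>x y c. x \<in> D \<Longrightarrow> y \<in> D \<Longrightarrow> p x (c *\<^sub>C y) = c * p x y"
    and symmetric: "\<And>x y. x \<in> D \<Longrightarrow> y \<in> D \<Longrightarrow> p x y = cnj (p y x)"
    and nonneg: "\<And>x. x \<in> D \<Longrightarrow> 0 \<le> Re (p x x)"
begin

lemma D_add [intro]: "x \<in> D \<Longrightarrow> y \<in> D \<Longrightarrow> x + y \<in> D"
  using subspace complex_vector.subspace_add by blast

lemma D_scale [intro]: "x \<in> D \<Longrightarrow> c *\<^sub>C x \<in> D"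
  using subspace complex_vector.subspace_scale by blast

lemma D_diff [intro]: "x \<in> D \<Longrightarrow> y \<in> D \<Longrightarrow> x - y \<in> D"
  using subspace complex_vector.subspace_diff by blast

lemma D_zero [intro]: "0 \<in> D"
  using subspace complex_vector.subspace_0 by blast

lemma add_left: "x \<in> D \<Longrightarrow> y \<in> D \<Longrightarrow> z \<in> D \<Longrightarrow> p (x + y) z = p x z + p y z"
  by (metis D_add add_right symmetric complex_cnj_add)

lemma scale_left: "x \<in> D \<Longrightarrow> y \<in> D \<Longrightarrow> p (c *\<^sub>C x) y = cnj c * p x y"
  by (metis D_scale scale_right symmetric complex_cnj_mult)

lemma diff_right: "x \<in> D \<Longrightarrow> y \<in> D \<Longrightarrow> z \<in> D \<Longrightarrow> p x (y - z) = p x y - p x z"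
  using add_right[of x y "(-1) *\<^sub>C z"] scale_right[of x z "-1"] D_scale[of z "-1"]
  by (simp add: scaleC_neg_one)

lemma diff_left: "x \<in> D \<Longrightarrow> y \<in> D \<Longrightarrow> z \<in> D \<Longrightarrow> p (x - y) z = p x z - p y z"
  by (metis D_diff diff_right symmetric complex_cnj_diff)

lemma diagonal: "x \<in> D \<Longrightarrow> Im (p x x) = 0"
  using arg_cong[OF symmetric[of x x], of Im] by simp

lemma expand_scale:
  assumes "x \<in> D" "y \<in> D"
  shows "Re (p (x + c *\<^sub>C y) (x + c *\<^sub>C y))
    = Re (p x x) + 2 * Re (c * p x y) + (cmod c)\<^sup>2 * Re (p y y)"
proof -
  have "p (x + c *\<^sub>C y) (x + c *\<^sub>C y)
      = p x x + (c * p x y + cnj (c * p x y)) + (c * cnj c) * p y y"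
    using assms symmetric[of y x]
    by (simp add: add_left add_right scale_left scale_right D_add D_scale algebra_simps)
  then show ?thesis
    using diagonal[OF assms(2)] by (simp add: complex_mult_cnj cmod_power2)
qed

lemma diagonal_scale:
  assumes "x \<in> D"
  shows "Re (p (c *\<^sub>C x) (c *\<^sub>C x)) = (cmod c)\<^sup>2 * Re (p x x)"
proof -
  have "p (c *\<^sub>C x) (c *\<^sub>C x) = (c * cnj c) * p x x"
    using assms by (simp add: scale_left scale_right D_scale)
  then show ?thesis by (simp add: complex_mult_cnj cmod_power2)
qed

lemma expand_diff:
  assumes "x \<in> D" "y \<in> D"
  shows "Re (p (x - y) (x - y)) = Re (p x x) - 2 * Re (p x y) + Re (p y y)"
  using expand_scale[OF assms, of "-1"] by (simp add: scaleC_neg_one)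

lemma expand_add:
  assumes "x \<in> D" "y \<in> D"
  shows "Re (p (x + y) (x + y)) = Re (p x x) + 2 * Re (p x y) + Re (p y y)"
  using expand_scale[OF assms, of 1] scaleR_scaleC[of 1 y] by simp

lemma Cauchy_Schwarz:
  assumes "x \<in> D" "y \<in> D"
  shows "(cmod (p x y))\<^sup>2 \<le> Re (p x x) * Re (p y y)"
proof -
  define a where "a = Re (p x x)"
  define b where "b = Re (p y y)"
  define m where "m = (cmod (p x y))\<^sup>2"
  have ab: "0 \<le> a" "0 \<le> b" "0 \<le> m"
    using nonneg assms by (auto simp: a_def b_def m_def)
  \<comment> \<open>The form is nonnegative on the line through \<open>x\<close> in the direction of the phase-corrected \<open>y\<close>.\<close>
  have quad: "0 \<le> a - 2 * r * m + r\<^sup>2 * m * b" for r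
  proof -
    have "0 \<le> Re (p (x + (- of_real r * cnj (p x y)) *\<^sub>C y) (x + (- of_real r * cnj (p x y)) *\<^sub>C y))"
      using assms by (intro nonneg) auto
    also have "\<dots> = a - 2 * r * m + r\<^sup>2 * m * b"
    proof -
      have "Re ((- of_real r * cnj (p x y)) * p x y) = - r * m"
        by (simp add: m_def cmod_power2) (simp add: power2_eq_square algebra_simps)
      moreover have "(cmod (- of_real r * cnj (p x y)))\<^sup>2 = r\<^sup>2 * m"
        by (simp add: m_def norm_mult power_mult_distrib)
      ultimately show ?thesis
        by (subst expand_scale[OF assms]) (simp add: a_def b_def)
    qed
    finally show ?thesis .
  qed
  have "m \<le> a * b"
  proof (cases "b = 0")
    case True
    \<comment> \<open>A nonconstant affine function of \<open>r\<close> takes negative values; this \<open>r\<close> produces the value \<open>-1\<close>.\<close>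
    have "m = 0"
    proof (rule ccontr)
      assume "m \<noteq> 0"
      then have "a - 2 * ((a + 1) / (2 * m)) * m = - 1" by (simp add: field_simps)
      with quad[of "(a + 1) / (2 * m)"] True show False by simp
    qed
    with ab show ?thesis by simp
  next
    case False
    then have "b > 0" using ab by simp
    \<comment> \<open>The quadratic polynomial in \<open>r\<close> is minimal at \<open>r = 1 / b\<close>.\<close>
    then have "a - 2 * (1 / b) * m + (1 / b)\<^sup>2 * m * b = a - m / b"
      by (simp add: field_simps power2_eq_square)
    with quad[of "1 / b"] have "m / b \<le> a" by simp
    with \<open>b > 0\<close> show ?thesis by (simp add: field_simps)
  qed
  then show ?thesis by (simp add: a_def b_def m_def)
qed

text \<open>The sequence minimizes the energy \<open>p x x - 2 * Re (l x)\<close>: the parallelogram law makes every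
  minimizing sequence Cauchy, and the first variation at an approximate minimum is small. Passing to the
  limit of the sequence gives the Riesz representation theorem in two different complete spaces, the
  Hilbert space and the domain of a closed form.\<close>

lemma riesz_sequence:
  assumes l_add: "\<And>x y. x \<in> D \<Longrightarrow> y \<in> D \<Longrightarrow> l (x + y) = l x + l y"
    and l_scale: "\<And>c x. x \<in> D \<Longrightarrow> l (c *\<^sub>C x) = c * l x"
    and l_bound: "\<And>x. x \<in> D \<Longrightarrow> (cmod (l x))\<^sup>2 \<le> C * Re (p x x)"
  obtains s where "\<And>n. s n \<in> D"
    and "\<And>e. 0 < e \<Longrightarrow> \<exists>N. \<forall>m\<ge>N. \<forall>n\<ge>N. Re (p (s m - s n) (s m - s n)) < e"
    and "\<And>y. y \<in> D \<Longrightarrow> (\<lambda>n. p (s n) y) \<longlonglongrightarrow> l y"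
proof -
  define J where "J x = Re (p x x) - 2 * Re (l x)" for x
  define m where "m = Inf (J ` D)"
  have J_ge: "- max C 0 \<le> J x" if "x \<in> D" for x
  proof -
    have a0: "0 \<le> Re (p x x)" using nonneg that .
    have "(cmod (l x))\<^sup>2 \<le> max C 0 * Re (p x x)"
      using l_bound[OF that] a0 by (meson max.cobounded1 mult_right_mono order_trans)
    moreover have "4 * (max C 0 * Re (p x x)) \<le> (max C 0 + Re (p x x))\<^sup>2"
      using zero_le_power2[of "max C 0 - Re (p x x)"] by (simp add: power2_eq_square algebra_simps)
    ultimately have "(2 * cmod (l x))\<^sup>2 \<le> (max C 0 + Re (p x x))\<^sup>2"
      by (simp add: power_mult_distrib)
    then have "2 * cmod (l x) \<le> max C 0 + Re (p x x)"
      by (rule power2_le_imp_le) (use a0 in auto)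
    then show ?thesis
      using complex_Re_le_cmod[of "l x"] by (simp add: J_def)
  qed
  then have bdd: "bdd_below (J ` D)" by (auto intro!: bdd_belowI2)
  have m_le: "m \<le> J x" if "x \<in> D" for x
    unfolding m_def using bdd that by (rule cINF_lower)
  have "\<exists>x\<in>D. J x < m + 1 / real (Suc n)" for n
  proof (rule ccontr)
    assume "\<not> ?thesis"
    then have "m + 1 / real (Suc n) \<le> m"
      unfolding m_def using D_zero by (intro cINF_greatest) (auto simp: not_less m_def)
    then show False by simp
  qed
  then obtain s where sD: "\<And>n. s n \<in> D" and sJ: "\<And>n. J (s n) < m + 1 / real (Suc n)"
    by metis
  have parallelogram: "Re (p (s n - s k) (s n - s k)) \<le> 2 / real (Suc n) + 2 / real (Suc k)" for n k
  proof -
    let ?h = "complex_of_real (1/2) *\<^sub>C (s n + s k)"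
    have w: "s n + s k \<in> D" and h: "?h \<in> D" using sD by blast+
    have ph: "p ?h ?h = p (s n + s k) (s n + s k) / 4"
      using w h by (simp only: scale_left scale_right) simp
    have lh: "l ?h = (l (s n) + l (s k)) / 2"
      using w sD by (simp only: l_scale l_add) simp
    have "J ?h = Re (p (s n + s k) (s n + s k)) / 4 - Re (l (s n)) - Re (l (s k))"
      unfolding J_def ph lh by (simp add: field_simps)
    moreover have "m \<le> J ?h" using m_le h .
    ultimately have "4 * m \<le> Re (p (s n + s k) (s n + s k)) - 4 * Re (l (s n)) - 4 * Re (l (s k))"
      by simp
    then show ?thesis
      using sJ[of n] sJ[of k] expand_add[OF sD sD, of n k] expand_diff[OF sD sD, of n k]
      by (simp add: J_def)
  qed
  show ?thesis
  proof
    show "s n \<in> D" for n by fact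
    show "\<exists>N. \<forall>m\<ge>N. \<forall>n\<ge>N. Re (p (s m - s n) (s m - s n)) < e" if e: "0 < e" for e
    proof -
      obtain N where N: "N > 0" "1 / real N < e / 4"
        using real_arch_inverse[of "e / 4"] e by (auto simp: inverse_eq_divide)
      have small: "2 / real (Suc n) < e / 2" if "n \<ge> N" for n
      proof -
        have "1 / real (Suc n) \<le> 1 / real N" using that N by (intro divide_left_mono) auto
        with N show ?thesis by simp
      qed
      have "Re (p (s m - s n) (s m - s n)) < e" if "m \<ge> N" "n \<ge> N" for m n
        using parallelogram[of m n] small[OF that(1)] small[OF that(2)] by linarith
      then show ?thesis by blast
    qed
    show "(\<lambda>n. p (s n) y) \<longlonglongrightarrow> l y" if y: "y \<in> D" for y
    proof -
      define b where "b = Re (p y y) + 1"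
      have b: "b > 0" using nonneg[OF y] by (simp add: b_def)
      have est: "(cmod (p (s n) y - l y))\<^sup>2 \<le> b * (1 / real (Suc n))" for n
      proof -
        define d where "d = p (s n) y - l y"
        define M where "M = (cmod d)\<^sup>2"
        \<comment> \<open>A step against the defect \<open>d\<close>. The summand 1 in \<open>b\<close> keeps the step finite when \<open>p y y = 0\<close>.\<close>
        let ?c = "- of_real (1 / b) * cnj d"
        have "m \<le> J (s n + ?c *\<^sub>C y)"
          using sD y by (intro m_le) auto
        also have "\<dots> = J (s n) + 2 * Re (?c * d) + (cmod ?c)\<^sup>2 * Re (p y y)"
        proof -
          have "l (s n + ?c *\<^sub>C y) = l (s n) + ?c * l y"
            using sD y by (simp only: l_add l_scale D_scale)
          then show ?thesis
            by (simp only: J_def expand_scale[OF sD y] d_def right_diff_distrib) simp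
        qed
        also have "Re (?c * d) = - M / b"
          by (simp add: M_def cmod_power2) (simp add: power2_eq_square add_divide_distrib diff_divide_distrib)
        also have "(cmod ?c)\<^sup>2 = M / b\<^sup>2"
          using b by (simp add: M_def norm_mult norm_divide power_mult_distrib power_divide)
        also have "M / b\<^sup>2 * Re (p y y) \<le> M / b\<^sup>2 * b"
          by (intro mult_left_mono) (auto simp: b_def M_def)
        also have "M / b\<^sup>2 * b = M / b" using b by (simp add: power2_eq_square)
        finally have "M / b \<le> 1 / real (Suc n)" using sJ[of n] by simp
        then show ?thesis using b by (simp add: M_def d_def field_simps)
      qed
      have "(\<lambda>n. b * (1 / real (Suc n))) \<longlonglongrightarrow> 0"
        by (rule tendsto_mult_right_zero[OF LIMSEQ_Suc[OF lim_1_over_n]])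
      moreover have "\<forall>n. norm ((cmod (p (s n) y - l y))\<^sup>2) \<le> b * (1 / real (Suc n))"
        using est by simp
      ultimately have "(\<lambda>n. (cmod (p (s n) y - l y))\<^sup>2) \<longlonglongrightarrow> 0"
        by (rule Lim_null_comparison[OF always_eventually, rotated])
      then have "(\<lambda>n. p (s n) y - l y) \<longlonglongrightarrow> 0"
        using tendsto_real_sqrt[of "\<lambda>n. (cmod (p (s n) y - l y))\<^sup>2" 0]
        by (simp add: tendsto_norm_zero_iff)
      then show ?thesis by (simp add: LIM_zero_iff)
    qed
  qed
qed

end

lemma hermitian_form_cinner:
  "complex_vector.subspace D \<Longrightarrow> hermitian_form D (cinner :: 'a::complex_inner \<Rightarrow> _)"
  by unfold_locales (simp_all add: cinner_simps cinner_ge_zero cinner_commute[symmetric])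

lemma cinner_norm_le: "cmod (cinner x y) \<le> norm x * norm (y::'a::complex_inner)"
proof -
  interpret hermitian_form UNIV "cinner :: 'a \<Rightarrow> _"
    by (rule hermitian_form_cinner) simp
  have "(cmod (cinner x y))\<^sup>2 \<le> (norm x * norm y)\<^sup>2"
    using Cauchy_Schwarz[of x y] by (simp add: cinner_self power_mult_distrib)
  then show ?thesis by (simp add: power2_le_iff_abs_le)
qed

lemma bounded_bilinear_cinner: "bounded_bilinear (cinner :: 'a::complex_inner \<Rightarrow> _)"
proof
  show "\<exists>K. \<forall>x y. norm (cinner x (y::'a)) \<le> norm x * norm y * K"
    by (rule exI[of _ 1]) (simp add: cinner_norm_le)
qed (simp_all add: cinner_simps scaleR_conv_of_real)

lemmas tendsto_cinner = bounded_bilinear.tendsto[OF bounded_bilinear_cinner]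

lemma norm_scaleC: "norm (c *\<^sub>C x) = cmod c * norm (x::'a::complex_inner)"
proof -
  have "cinner (c *\<^sub>C x) (c *\<^sub>C x) = (c * cnj c) * cinner x x"
    by (simp add: cinner_scaleC_left cinner_scaleC_right)
  then have "of_real ((norm (c *\<^sub>C x))\<^sup>2) = complex_of_real ((cmod c)\<^sup>2 * (norm x)\<^sup>2)"
    unfolding cinner_self complex_norm_square[symmetric] of_real_mult .
  then have "(norm (c *\<^sub>C x))\<^sup>2 = (cmod c * norm x)\<^sup>2"
    unfolding of_real_eq_iff power_mult_distrib .
  then show ?thesis by simp
qed

lemma tendsto_scaleC:
  assumes "(s \<longlongrightarrow> x) G" shows "((\<lambda>n. c *\<^sub>C s n) \<longlongrightarrow> c *\<^sub>C (x::'a::complex_inner)) G"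
proof -
  have "((\<lambda>n. norm (c *\<^sub>C (s n - x))) \<longlongrightarrow> 0) G"
    using tendsto_mult_right_zero[OF tendsto_norm_zero[OF LIM_zero[OF assms]], of "cmod c"]
    by (simp add: norm_scaleC)
  then have "((\<lambda>n. c *\<^sub>C (s n - x)) \<longlongrightarrow> 0) G" by (simp add: tendsto_norm_zero_iff)
  then show ?thesis
    by (simp add: complex_vector.scale_right_diff_distrib LIM_zero_iff)
qed

lemma bounded_clinearI:
  assumes "\<And>x y. T (x + y) = T x + T y" "\<And>c x. T (c *\<^sub>C x) = c *\<^sub>C T x"
    and "\<And>x. norm (T x) \<le> K * norm x"
  shows "bounded_clinear T"
  unfolding bounded_clinear_def
  using assms by (auto intro!: bounded_linear_intro[where K = K] simp: scaleR_scaleC mult.commute)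

lemma bounded_clinearD:
  assumes "bounded_clinear T"
  shows "bounded_linear T" "T (x + y) = T x + T y" "T (x - y) = T x - T y"
    "T (c *\<^sub>C x) = c *\<^sub>C T x" "T (r *\<^sub>R x) = r *\<^sub>R T x" "T 0 = 0"
  using assms unfolding bounded_clinear_def
  by (auto simp: linear_simps linear_add linear_diff linear_scale linear_0 bounded_linear.linear)

lemma cinner_dense_eq:
  fixes u v :: "'a::complex_inner"
  assumes "closure D = UNIV" "\<And>y. y \<in> D \<Longrightarrow> cinner u y = cinner v y"
  shows "u = v"
proof -
  obtain s where s: "\<And>n. s n \<in> D" "s \<longlonglongrightarrow> u - v"
    using assms(1) closure_sequential[of "u - v" D] by auto
  have "(\<lambda>n. cinner (u - v) (s n)) \<longlonglongrightarrow> cinner (u - v) (u - v)"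
    using s by (intro tendsto_cinner tendsto_const)
  moreover have "cinner (u - v) (s n) = 0" for n
    using assms(2) s by (simp add: cinner_diff_left)
  ultimately have "cinner (u - v) (u - v) = 0"
    by (simp add: LIMSEQ_const_iff)
  then show ?thesis by (simp add: cinner_self)
qed

lemma cinner_dense_eq_right:
  fixes u v :: "'a::complex_inner"
  assumes "closure D = UNIV" "\<And>y. y \<in> D \<Longrightarrow> cinner y u = cinner y v"
  shows "u = v"
  using assms(1) by (rule cinner_dense_eq) (metis assms(2) cinner_commute)

lemma Cauchy_of_square_norm:
  fixes s :: "nat \<Rightarrow> 'a::real_normed_vector"
  assumes "\<And>e. 0 < e \<Longrightarrow> \<exists>N. \<forall>m\<ge>N. \<forall>n\<ge>N. (norm (s m - s n))\<^sup>2 < e"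
  shows "Cauchy s"
proof (rule metric_CauchyI)
  fix e :: real assume e: "0 < e"
  then obtain N where N: "\<forall>m\<ge>N. \<forall>n\<ge>N. (norm (s m - s n))\<^sup>2 < e\<^sup>2"
    using assms[of "e\<^sup>2"] by auto
  have "dist (s m) (s n) < e" if "m \<ge> N" "n \<ge> N" for m n
    using N that e power_less_imp_less_base[of "norm (s m - s n)" 2 e] by (simp add: dist_norm)
  then show "\<exists>N. \<forall>m\<ge>N. \<forall>n\<ge>N. dist (s m) (s n) < e" by blast
qed

text \<open>The representing vector is a limit of vectors of \<open>D\<close>. Its location in the closure replaces the
  orthogonal projection onto a closed subspace when a range is shown to be dense below.\<close>

lemma riesz_subspace:
  fixes l :: "'a::chilbert_space \<Rightarrow> complex"
  assumes "complex_vector.subspace D"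
    and "\<And>x y. x \<in> D \<Longrightarrow> y \<in> D \<Longrightarrow> l (x + y) = l x + l y"
    and "\<And>c x. x \<in> D \<Longrightarrow> l (c *\<^sub>C x) = c * l x"
    and "\<And>x. x \<in> D \<Longrightarrow> cmod (l x) \<le> C * norm x"
  obtains z where "z \<in> closure D" "\<And>x. x \<in> D \<Longrightarrow> l x = cinner z x"
proof -
  interpret hermitian_form D "cinner :: 'a \<Rightarrow> _"
    using assms(1) by (rule hermitian_form_cinner)
  have "(cmod (l x))\<^sup>2 \<le> C\<^sup>2 * Re (cinner x x)" if "x \<in> D" for x
    using power_mono[OF assms(4)[OF that], of 2] by (simp add: cinner_self power_mult_distrib)
  from riesz_sequence[OF assms(2,3) this]
  obtain s where s: "\<And>n. s n \<in> D"
    "\<And>e. 0 < e \<Longrightarrow> \<exists>N. \<forall>m\<ge>N. \<forall>n\<ge>N. Re (cinner (s m - s n) (s m - s n)) < e"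
    "\<And>y. y \<in> D \<Longrightarrow> (\<lambda>n. cinner (s n) y) \<longlonglongrightarrow> l y"
    by blast
  have "Cauchy s"
    using s(2) by (intro Cauchy_of_square_norm) (simp add: cinner_self)
  then obtain z where z: "s \<longlonglongrightarrow> z"
    using Cauchy_convergent_iff convergent_def by blast
  have "l y = cinner z y" if "y \<in> D" for y
    using LIMSEQ_unique[OF s(3)[OF that] tendsto_cinner[OF z tendsto_const]] .
  moreover have "z \<in> closure D" using s(1) z closure_sequential by blast
  ultimately show ?thesis using that by blast
qed

section \<open>Square roots of positive contractions\<close>

text \<open>A fixed point \<open>Y\<close> of the iteration \<open>Y \<mapsto> (X + Y\<^sup>2) / 2\<close> satisfies \<open>(1 - Y)\<^sup>2 = 1 - X\<close>.\<close>

primrec sqrt_iter :: "('a \<Rightarrow> 'a) \<Rightarrow> nat \<Rightarrow> 'a \<Rightarrow> 'a::complex_inner" where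
  "sqrt_iter X 0 x = 0"
| "sqrt_iter X (Suc n) x = (1 / 2) *\<^sub>R (X x + sqrt_iter X n (sqrt_iter X n x))"

text \<open>The same iteration for the number 1 in place of \<open>X\<close>; it dominates the iteration for every
  contraction \<open>X\<close>.\<close>

primrec sqrt_bound :: "nat \<Rightarrow> real" where
  "sqrt_bound 0 = 0"
| "sqrt_bound (Suc n) = (1 + (sqrt_bound n)\<^sup>2) / 2"

declare sqrt_iter.simps(2) [simp del] sqrt_bound.simps(2) [simp del]

lemma sqrt_bound_le: "0 \<le> sqrt_bound n \<and> sqrt_bound n \<le> 1"
proof (induction n)
  case (Suc n)
  then have "(sqrt_bound n)\<^sup>2 \<le> 1" by (intro power_le_one) auto
  then show ?case by (simp add: sqrt_bound.simps(2))
qed simp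

lemma sqrt_bound_mono: "sqrt_bound n \<le> sqrt_bound (Suc n)"
  using zero_le_power2[of "1 - sqrt_bound n"] by (simp add: sqrt_bound.simps(2) power2_eq_square field_simps)

text \<open>The iterates commute, so \<open>Y\<^sub>n\<^sub>+\<^sub>2 - Y\<^sub>n\<^sub>+\<^sub>1 = (Y\<^sub>n\<^sub>+\<^sub>1 + Y\<^sub>n) (Y\<^sub>n\<^sub>+\<^sub>1 - Y\<^sub>n) / 2\<close>, and by induction the norms of the
  increments are bounded by the increments of the scalar iteration. These are summable even when
  \<open>X\<close> has norm 1, the case that occurs for an unbounded form.\<close>

lemma contraction_sqrt:
  fixes X :: "'a::chilbert_space \<Rightarrow> 'a"
  assumes X: "bounded_clinear X" and symm: "\<And>x y. cinner (X x) y = cinner x (X y)"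
    and contr: "\<And>x. norm (X x) \<le> norm x"
  obtains Y where "bounded_clinear Y" "\<And>x y. cinner (Y x) y = cinner x (Y y)"
    "\<And>x. norm (Y x) \<le> norm x" "\<And>x. (x - Y x) - Y (x - Y x) = x - X x"
    "\<And>Z x. bounded_clinear Z \<Longrightarrow> (\<And>x. Z (X x) = X (Z x)) \<Longrightarrow> Z (Y x) = Y (Z x)"
proof -
  let ?Y = "sqrt_iter X"
  let ?y = sqrt_bound
  have add: "?Y n (x + y) = ?Y n x + ?Y n y" and scale: "?Y n (c *\<^sub>C x) = c *\<^sub>C ?Y n x" for n x y c
    by (induction n arbitrary: x y)
      (auto simp: sqrt_iter.simps(2) bounded_clinearD[OF X] scaleR_add_right scaleR_scaleC scaleC_scaleC
        scaleC_add_right mult.commute)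
  have bound: "norm (?Y n x) \<le> ?y n * norm x" for n x
  proof (induction n arbitrary: x)
    case (Suc n)
    have "norm (?Y n (?Y n x)) \<le> ?y n * (?y n * norm x)"
      using Suc[of "?Y n x"] mult_left_mono[OF Suc[of x], of "?y n"] sqrt_bound_le[of n] by linarith
    then have "norm (X x + ?Y n (?Y n x)) \<le> norm x + ?y n * (?y n * norm x)"
      using contr[of x] norm_triangle_ineq[of "X x" "?Y n (?Y n x)"] by linarith
    then have "norm (X x + ?Y n (?Y n x)) / 2 \<le> ?y (Suc n) * norm x"
      by (simp add: sqrt_bound.simps(2) power2_eq_square field_simps)
    then show ?case by (simp add: sqrt_iter.simps(2))
  qed simp
  have bcl: "bounded_clinear (?Y n)" for n
    using add scale bound by (rule bounded_clinearI)
  note lin = bounded_clinearD[OF bcl]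
  have sym: "cinner (?Y n x) y = cinner x (?Y n y)" for n x y
    by (induction n arbitrary: x y) (auto simp: sqrt_iter.simps(2) cinner_simps symm)
  have comm: "Z (?Y n x) = ?Y n (Z x)" if "bounded_clinear Z" "\<And>x. Z (X x) = X (Z x)" for Z n x
    by (induction n arbitrary: x) (auto simp: sqrt_iter.simps(2) bounded_clinearD[OF that(1)] that(2))
  have comm': "?Y m (?Y n x) = ?Y n (?Y m x)" for m n x
    by (rule comm[OF bcl]) (rule comm[OF X, symmetric], rule refl)
  have step: "norm (?Y (Suc n) x - ?Y n x) \<le> (?y (Suc n) - ?y n) * norm x" for n x
  proof (induction n arbitrary: x)
    case 0
    then show ?case using contr by (simp add: sqrt_iter.simps(2) sqrt_bound.simps(2))
  next
    case (Suc n)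
    let ?d = "?Y (Suc n) x - ?Y n x"
    have "?Y (Suc (Suc n)) x - ?Y (Suc n) x
        = (1/2) *\<^sub>R (?Y (Suc n) (?Y (Suc n) x) - ?Y n (?Y n x))"
      by (simp only: sqrt_iter.simps(2)[of X "Suc n" x] sqrt_iter.simps(2)[of X n x]
        scaleR_diff_right[symmetric] add_diff_cancel_left)
    also have "?Y (Suc n) (?Y (Suc n) x) - ?Y n (?Y n x) = ?Y (Suc n) ?d + ?Y n ?d"
      using comm'[of "Suc n" n x] by (simp add: lin)
    finally have "norm (?Y (Suc (Suc n)) x - ?Y (Suc n) x) = norm (?Y (Suc n) ?d + ?Y n ?d) / 2"
      by simp
    also have "\<dots> \<le> (?y (Suc n) * norm ?d + ?y n * norm ?d) / 2"
      by (intro divide_right_mono order_trans[OF norm_triangle_ineq] add_mono bound) simp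
    also have "\<dots> = (?y (Suc n) + ?y n) / 2 * norm ?d" by (simp add: field_simps)
    also have "\<dots> \<le> (?y (Suc n) + ?y n) / 2 * ((?y (Suc n) - ?y n) * norm x)"
      using sqrt_bound_le[of n] sqrt_bound_le[of "Suc n"] by (intro mult_left_mono Suc) auto
    also have "\<dots> = (?y (Suc (Suc n)) - ?y (Suc n)) * norm x"
    proof -
      have "(1 + v\<^sup>2) / 2 - (1 + u\<^sup>2) / 2 = (v + u) / 2 * (v - u)" for u v :: real
        by (simp add: power2_eq_square field_simps)
      then have "?y (Suc (Suc n)) - ?y (Suc n) = (?y (Suc n) + ?y n) / 2 * (?y (Suc n) - ?y n)"
        using sqrt_bound.simps(2)[of "Suc n"] sqrt_bound.simps(2)[of n] by metis
      then show ?thesis by simp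
    qed
    finally show ?case .
  qed
  have mono: "incseq ?y" by (rule incseq_SucI) (rule sqrt_bound_mono)
  have diff: "norm (?Y m x - ?Y n x) \<le> (?y m - ?y n) * norm x" if "n \<le> m" for m n x
    using that
  proof (induction rule: dec_induct)
    case (step k)
    have "norm (?Y (Suc k) x - ?Y n x) \<le> norm (?Y (Suc k) x - ?Y k x) + norm (?Y k x - ?Y n x)"
      using norm_triangle_ineq[of "?Y (Suc k) x - ?Y k x" "?Y k x - ?Y n x"] by simp
    also have "\<dots> \<le> (?y (Suc k) - ?y k) * norm x + (?y k - ?y n) * norm x"
      using step \<open>norm (?Y (Suc k) x - ?Y k x) \<le> _\<close> by (intro add_mono)
    also have "\<dots> = (?y (Suc k) - ?y n) * norm x" by (simp only: algebra_simps)
    finally show ?case .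
  qed simp
  have "\<forall>i. ?y i \<le> 1" using sqrt_bound_le by blast
  then obtain L where "?y \<longlonglongrightarrow> L" using incseq_convergent[OF mono] by blast
  then have Cy: "Cauchy ?y" by (rule LIMSEQ_imp_Cauchy)
  have "Cauchy (\<lambda>n. ?Y n x)" for x
  proof (rule metric_CauchyI)
    fix e :: real assume "0 < e"
    then have "0 < e / (norm x + 1)" by (simp add: add_nonneg_pos)
    from metric_CauchyD[OF Cy this] obtain N
      where N: "\<And>m n. m \<ge> N \<Longrightarrow> n \<ge> N \<Longrightarrow> \<bar>?y m - ?y n\<bar> < e / (norm x + 1)"
      by (auto simp: dist_real_def)
    have *: "dist (?Y m x) (?Y n x) < e" if "n \<ge> N" "m \<ge> n" for m n
    proof -
      have "norm (?Y m x - ?Y n x) \<le> (?y m - ?y n) * norm x" using diff that by simp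
      also have "\<dots> \<le> (?y m - ?y n) * (norm x + 1)"
        using incseqD[OF mono that(2)] by (intro mult_left_mono) auto
      also have "\<dots> < e / (norm x + 1) * (norm x + 1)"
        using N[of m n] that by (intro mult_strict_right_mono) (auto simp: add_nonneg_pos)
      also have "\<dots> = e"
        using norm_ge_zero[of x] by (simp add: add_nonneg_eq_0_iff)
      finally show ?thesis by (simp add: dist_norm)
    qed
    show "\<exists>N. \<forall>m\<ge>N. \<forall>n\<ge>N. dist (?Y m x) (?Y n x) < e"
      using * by (metis dist_commute nle_le)
  qed
  then have "\<exists>z. (\<lambda>n. ?Y n x) \<longlonglongrightarrow> z" for x
    using Cauchy_convergent_iff convergent_def by blast
  then obtain Y where Y: "\<And>x. (\<lambda>n. ?Y n x) \<longlonglongrightarrow> Y x" by metis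
  have Yb: "norm (Y x) \<le> norm x" for x
  proof (rule LIMSEQ_le_const2[OF tendsto_norm[OF Y[of x]]])
    have "?y n * norm x \<le> 1 * norm x" for n
      using sqrt_bound_le[of n] by (intro mult_right_mono) auto
    then show "\<exists>N. \<forall>n\<ge>N. norm (?Y n x) \<le> norm x"
      using bound[of _ x] by (metis mult_1 order_trans)
  qed
  have Yadd: "Y (x + y) = Y x + Y y" for x y
    using LIMSEQ_unique[OF Y[of "x + y"]] tendsto_add[OF Y[of x] Y[of y]] by (simp add: add)
  have Yscale: "Y (c *\<^sub>C x) = c *\<^sub>C Y x" for c x
    using LIMSEQ_unique[OF Y[of "c *\<^sub>C x"]] tendsto_scaleC[OF Y[of x]] by (simp add: scale)
  have Ybcl: "bounded_clinear Y"
    using Yadd Yscale Yb by (intro bounded_clinearI[where K = 1]) auto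
  show ?thesis
  proof
    show "bounded_clinear Y" by fact
    show "norm (Y x) \<le> norm x" for x by fact
    show "cinner (Y x) y = cinner x (Y y)" for x y
      using LIMSEQ_unique[OF tendsto_cinner[OF Y[of x] tendsto_const[of y]]]
        tendsto_cinner[OF tendsto_const[of x] Y[of y]] by (simp add: sym)
    show "Z (Y x) = Y (Z x)" if "bounded_clinear Z" "\<And>x. Z (X x) = X (Z x)" for Z x
      using LIMSEQ_unique[OF bounded_linear.tendsto[OF bounded_clinearD(1)[OF that(1)] Y[of x]]]
        Y[of "Z x"] comm[OF that] by simp
    show "(x - Y x) - Y (x - Y x) = x - X x" for x
    proof -
      have "(\<lambda>n. ?Y n (?Y n x - Y x)) \<longlonglongrightarrow> 0"
      proof (rule Lim_null_comparison[OF always_eventually])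
        show "\<forall>n. norm (?Y n (?Y n x - Y x)) \<le> norm (?Y n x - Y x)"
        proof
          fix n
          have "norm (?Y n (?Y n x - Y x)) \<le> ?y n * norm (?Y n x - Y x)" by (rule bound)
          also have "\<dots> \<le> 1 * norm (?Y n x - Y x)"
            using sqrt_bound_le[of n] by (intro mult_right_mono) auto
          finally show "norm (?Y n (?Y n x - Y x)) \<le> norm (?Y n x - Y x)" by simp
        qed
        show "(\<lambda>n. norm (?Y n x - Y x)) \<longlonglongrightarrow> 0"
          by (rule tendsto_norm_zero[OF LIM_zero[OF Y]])
      qed
      from tendsto_add[OF this Y[of "Y x"]] have "(\<lambda>n. ?Y n (?Y n x)) \<longlonglongrightarrow> Y (Y x)"
        by (simp add: lin)
      then have "(\<lambda>n. ?Y (Suc n) x) \<longlonglongrightarrow> (1/2) *\<^sub>R (X x + Y (Y x))"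
        unfolding sqrt_iter.simps by (intro tendsto_intros)
      with LIMSEQ_Suc[OF Y[of x]] have eq: "Y x = (1/2) *\<^sub>R (X x + Y (Y x))"
        by (rule LIMSEQ_unique)
      have "Y x + Y x = X x + Y (Y x)"
        by (subst (1 2) eq) (simp flip: scaleR_add_left)
      then show ?thesis
        by (simp add: bounded_clinearD[OF Ybcl] algebra_simps)
    qed
  qed
qed

lemma cinner_nonneg_of_contraction:
  assumes "norm (x - y) \<le> norm (x::'a::complex_inner)"
  shows "0 \<le> Re (cinner x y)"
proof -
  have "Re (cinner x (x - y)) \<le> norm x * norm (x - y)"
    using complex_Re_le_cmod cinner_norm_le order_trans by blast
  also have "\<dots> \<le> norm x * norm x"
    using assms by (intro mult_left_mono) auto
  finally show ?thesis by (simp add: cinner_diff_right cinner_self power2_eq_square)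
qed

lemma bounded_clinear_complement:
  assumes "bounded_clinear A" "\<And>x. norm (x - A x) \<le> norm x"
  shows "bounded_clinear (\<lambda>x. x - A x)"
  by (rule bounded_clinearI[where K = 1])
    (use assms(2) in \<open>auto simp: bounded_clinearD[OF assms(1)] complex_vector.scale_right_diff_distrib\<close>)

text \<open>Take \<open>X = 1 - A\<close> and \<open>R = 1 - Y\<close>. For symmetric \<open>A\<close>, the contraction property of \<open>1 - A\<close> means
  \<open>0 \<le> A \<le> 2\<close>. The root inherits it, so roots can be taken repeatedly.\<close>

lemma positive_sqrt:
  fixes A :: "'a::chilbert_space \<Rightarrow> 'a"
  assumes A: "bounded_clinear A" and symm: "\<And>x y. cinner (A x) y = cinner x (A y)"
    and contr: "\<And>x. norm (x - A x) \<le> norm x"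
  obtains R where "bounded_clinear R" "\<And>x y. cinner (R x) y = cinner x (R y)"
    "\<And>x. norm (x - R x) \<le> norm x" "\<And>x. R (R x) = A x"
    "\<forall>Z. bounded_clinear Z \<longrightarrow> (\<forall>x. Z (A x) = A (Z x)) \<longrightarrow> (\<forall>x. Z (R x) = R (Z x))"
proof -
  have symm': "cinner (x - A x) y = cinner x (y - A y)" for x y by (simp add: cinner_simps symm)
  show ?thesis
  proof (rule contraction_sqrt[OF bounded_clinear_complement[OF A contr] symm' contr])
    fix Y assume Y: "bounded_clinear Y" "\<And>x y. cinner (Y x) y = cinner x (Y y)"
      "\<And>x. norm (Y x) \<le> norm x" "\<And>x. (x - Y x) - Y (x - Y x) = x - (x - A x)"
      "\<And>Z x. bounded_clinear Z \<Longrightarrow> (\<And>x. Z (x - A x) = Z x - A (Z x)) \<Longrightarrow> Z (Y x) = Y (Z x)"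
    note Yl = bounded_clinearD[OF Y(1)]
    show thesis
    proof (rule that[of "\<lambda>x. x - Y x"])
      show "bounded_clinear (\<lambda>x. x - Y x)"
      proof (rule bounded_clinearI[where K = 2])
        show "norm (x - Y x) \<le> 2 * norm x" for x
          using norm_triangle_ineq4[of x "Y x"] Y(3)[of x] by linarith
      qed (simp_all add: Yl complex_vector.scale_right_diff_distrib)
      show "cinner (x - Y x) y = cinner x (y - Y y)" for x y by (simp add: cinner_simps Y(2))
      show "norm (x - (x - Y x)) \<le> norm x" for x by (simp add: Y(3))
      show "x - Y x - Y (x - Y x) = A x" for x using Y(4)[of x] by simp
      show "\<forall>Z. bounded_clinear Z \<longrightarrow> (\<forall>x. Z (A x) = A (Z x)) \<longrightarrow>
          (\<forall>x. Z (x - Y x) = Z x - Y (Z x))"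
      proof (intro allI impI)
        fix Z x assume Z: "bounded_clinear Z" "\<forall>x. Z (A x) = A (Z x)"
        have "Z (Y x) = Y (Z x)"
          by (rule Y(5)[OF Z(1)]) (simp add: bounded_clinearD[OF Z(1)] Z(2))
        then show "Z (x - Y x) = Z x - Y (Z x)" by (simp add: bounded_clinearD[OF Z(1)])
      qed
    qed
  qed
qed

section \<open>Operators given by forms\<close>

definition form_op :: "'a::complex_inner set \<Rightarrow> ('a \<Rightarrow> 'a \<Rightarrow> complex) \<Rightarrow> 'a \<rightharpoonup> 'a" where
  "form_op D q = (\<lambda>x. if x \<in> D \<and> (\<exists>z. \<forall>y\<in>D. q x y = cinner z y)
     then Some (THE z. \<forall>y\<in>D. q x y = cinner z y) else None)"

lemma form_op_eq_Some:
  assumes "closure D = UNIV"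
  shows "form_op D q x = Some z \<longleftrightarrow> x \<in> D \<and> (\<forall>y\<in>D. q x y = cinner z y)"
proof -
  have "(THE z. \<forall>y\<in>D. q x y = cinner z y) = z" if "\<forall>y\<in>D. q x y = cinner z y" for z
    using that by (intro the_equality) (auto intro: cinner_dense_eq[OF assms])
  then show ?thesis unfolding form_op_def by auto
qed

lemma adjoint_operator_eq_Some:
  assumes "closure (dom A) = UNIV"
  shows "adjoint_operator A y = Some z \<longleftrightarrow> (\<forall>x\<in>dom A. cinner y (the (A x)) = cinner z x)"
proof -
  define P where "P z \<longleftrightarrow> (\<forall>x\<in>dom A. cinner y (the (A x)) = cinner z x)" for z
  have "u = v" if "P u" "P v" for u v
    by (rule cinner_dense_eq[OF assms]) (metis P_def that)
  then have "(THE z. P z) = z" if "P z" for z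
    using that by blast
  moreover have "adjoint_operator A y = (if \<exists>z. P z then Some (THE z. P z) else None)"
    by (simp add: adjoint_operator_def P_def)
  ultimately have "adjoint_operator A y = Some z \<longleftrightarrow> P z" by auto
  then show ?thesis by (simp add: P_def)
qed

text \<open>Unfolding the adjoint at \<open>A x\<close> produces the defining condition of \<open>form_op\<close>, so \<open>A\<^sup>*A\<close>
  depends on \<open>A\<close> only through its domain and the form \<open>\<langle>A x|A y\<rangle>\<close>.\<close>

lemma adjoint_comp_self:
  assumes "dom A = D" and "\<And>x y. x \<in> D \<Longrightarrow> y \<in> D \<Longrightarrow> q x y = cinner (the (A x)) (the (A y))"
  shows "adjoint_operator A \<circ>\<^sub>m A = form_op D q"
proof
  fix x
  show "(adjoint_operator A \<circ>\<^sub>m A) x = form_op D q x"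
  proof (cases "A x")
    case None
    then have "x \<notin> D" using assms(1) by auto
    with None show ?thesis by (simp add: form_op_def)
  next
    case (Some v)
    then have "x \<in> D" using assms(1) by auto
    moreover have "\<forall>y\<in>D. q x y = cinner v (the (A y))"
      using assms(2)[OF \<open>x \<in> D\<close>] Some by simp
    ultimately show ?thesis
      by (simp add: Some form_op_def adjoint_operator_def assms(1) cong: ball_cong)
  qed
qed

lemma linear_adjoint_operator:
  fixes A :: "'a::complex_inner \<rightharpoonup> 'b::complex_inner"
  assumes "closure (dom A) = UNIV"
  shows "linear_operator (adjoint_operator A)"
proof -
  note iff = adjoint_operator_eq_Some[OF assms]
  have add: "adjoint_operator A (x + y) = Some (u + v)"
    if "adjoint_operator A x = Some u" "adjoint_operator A y = Some v" for x y u v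
    using that by (simp add: iff cinner_add_left)
  have scale: "adjoint_operator A (c *\<^sub>C x) = Some (c *\<^sub>C u)"
    if "adjoint_operator A x = Some u" for c x u
    using that by (simp add: iff cinner_scaleC_left)
  have zero: "adjoint_operator A 0 = Some 0" by (simp add: iff)
  show ?thesis
    unfolding linear_operator_def complex_vector.subspace_def
    using add scale zero by (fastforce simp: dom_def)
qed

lemma selfadjoint_operatorI:
  assumes "closure (dom T) = UNIV" "adjoint_operator T = T"
  shows "selfadjoint_operator T"
  using assms linear_adjoint_operator[OF assms(1)] by (simp add: selfadjoint_operator_def)

lemma subspace_range:
  assumes "bounded_clinear T"
  shows "complex_vector.subspace (range T)"
  unfolding complex_vector.subspace_def
  by (metis (no_types, lifting) bounded_clinearD(2,4,6)[OF assms] rangeE rangeI)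

text \<open>A vector and its Riesz representative in the closure of the range differ by a vector
  orthogonal to the range, which symmetry places in the kernel.\<close>

lemma dense_range_of_injective_symmetric:
  fixes R :: "'a::chilbert_space \<Rightarrow> 'a"
  assumes "bounded_clinear R" and symm: "\<And>x y. cinner (R x) y = cinner x (R y)"
    and inj: "\<And>x. R x = 0 \<Longrightarrow> x = 0"
  shows "closure (range R) = UNIV"
proof -
  have "w \<in> closure (range R)" for w
  proof -
    obtain z where z: "z \<in> closure (range R)" "\<And>x. x \<in> range R \<Longrightarrow> cinner w x = cinner z x"
      using riesz_subspace[OF subspace_range[OF assms(1)], of "cinner w" "norm w"]
      by (auto simp: cinner_add_right cinner_scaleC_right cinner_norm_le)
    have "cinner (R (w - z)) x = 0" for x
      using z(2)[of "R x"] by (simp add: symm cinner_diff_left)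
    then have "R (w - z) = 0" using cinner_self[of "R (w - z)"] by simp
    then have "w = z" using inj[of "w - z"] by simp
    with z show ?thesis by simp
  qed
  then show ?thesis by auto
qed

section \<open>Closed forms and selfadjoint operators\<close>

locale closed_hermitian_form = hermitian_form D p
  for D :: "'a::chilbert_space set" and p :: "'a \<Rightarrow> 'a \<Rightarrow> complex" +
  assumes dense: "closure D = UNIV" and closed: "closed_form D p"
begin

text \<open>The inner product of the graph norm. Closedness of the form means completeness of the domain
  in this norm.\<close>

definition energy :: "'a \<Rightarrow> 'a \<Rightarrow> complex" where
  "energy x y = cinner x y + p x y"

sublocale energy: hermitian_form D energy
  by unfold_locales
    (auto simp: energy_def subspace add_right scale_right cinner_simps algebra_simps
      cinner_ge_zero nonneg intro: cinner_commute symmetric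
      intro!: arg_cong2[where f = "(+)"])

lemma norm_le_energy: "x \<in> D \<Longrightarrow> (norm x)\<^sup>2 \<le> Re (energy x x)"
  using nonneg[of x] by (simp add: energy_def cinner_self)

lemma p_le_energy: "Re (p x x) \<le> Re (energy x x)"
  using cinner_ge_zero[of x] by (simp add: energy_def)

lemma cmod_diagonal: "x \<in> D \<Longrightarrow> cmod (p x x) = Re (p x x)"
  using nonneg[of x] diagonal[of x] by (simp add: cmod_def)

lemma energy_eqI:
  assumes "x \<in> D" "y \<in> D" "\<And>z. z \<in> D \<Longrightarrow> energy x z = energy y z"
  shows "x = y"
proof -
  have "energy (x - y) (x - y) = 0"
    using assms energy.diff_left[of x y "x - y"] by auto
  then have "(norm (x - y))\<^sup>2 \<le> 0"
    using norm_le_energy[of "x - y"] assms by auto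
  then show ?thesis by simp
qed

text \<open>Closedness of \<open>p\<close> gives convergence in the graph norm; the Cauchy-Schwarz inequality turns it into
  convergence of \<open>energy (s n) y\<close>, which is the form in which it is applied.\<close>

lemma energy_complete:
  assumes sD: "\<And>n. s n \<in> D"
    and cauchy: "\<And>e. 0 < e \<Longrightarrow> \<exists>N. \<forall>m\<ge>N. \<forall>n\<ge>N. Re (energy (s m - s n) (s m - s n)) < e"
  obtains x where "x \<in> D" "s \<longlonglongrightarrow> x" "\<And>y. y \<in> D \<Longrightarrow> (\<lambda>n. energy (s n) y) \<longlonglongrightarrow> energy x y"
proof -
  have "Cauchy s"
  proof (rule Cauchy_of_square_norm)
    fix e :: real assume "0 < e"
    then obtain N where N: "\<forall>m\<ge>N. \<forall>n\<ge>N. Re (energy (s m - s n) (s m - s n)) < e"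
      using cauchy by blast
    have "(norm (s m - s n))\<^sup>2 < e" if "m \<ge> N" "n \<ge> N" for m n
      using norm_le_energy[of "s m - s n"] N that D_diff[OF sD sD] by (meson le_less_trans)
    then show "\<exists>N. \<forall>m\<ge>N. \<forall>n\<ge>N. (norm (s m - s n))\<^sup>2 < e" by blast
  qed
  then obtain x where x: "s \<longlonglongrightarrow> x"
    using Cauchy_convergent_iff convergent_def by blast
  have "((\<lambda>(n, m). p (s n - s m) (s n - s m)) \<longlongrightarrow> 0) (sequentially \<times>\<^sub>F sequentially)"
  proof (rule tendstoI)
    fix e :: real assume "0 < e"
    then obtain N where N: "\<forall>m\<ge>N. \<forall>n\<ge>N. Re (energy (s m - s n) (s m - s n)) < e"
      using cauchy by blast
    have "cmod (p (s n - s m) (s n - s m)) < e" if "n \<ge> N" "m \<ge> N" for n m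
      using N that p_le_energy[of "s n - s m"] cmod_diagonal[OF D_diff[OF sD sD], of n m]
      by (metis le_less_trans)
    then show "\<forall>\<^sub>F nm in sequentially \<times>\<^sub>F sequentially.
        dist (case nm of (n, m) \<Rightarrow> p (s n - s m) (s n - s m)) 0 < e"
      unfolding eventually_prod_sequentially by auto
  qed
  with closed sD x have xD: "x \<in> D" and lim: "(\<lambda>n. p (s n - x) (s n - x)) \<longlonglongrightarrow> 0"
    unfolding closed_form_def by blast+
  have "(\<lambda>n. s n - x) \<longlonglongrightarrow> 0" using x by (rule LIM_zero)
  then have "(\<lambda>n. cinner (s n - x) (s n - x)) \<longlonglongrightarrow> cinner (0::'a) 0"
    using tendsto_cinner by blast
  from tendsto_add[OF this lim] have "(\<lambda>n. energy (s n - x) (s n - x)) \<longlonglongrightarrow> 0"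
    by (simp add: energy_def)
  then have elim: "(\<lambda>n. Re (energy (s n - x) (s n - x))) \<longlonglongrightarrow> 0"
    using tendsto_Re by fastforce
  have "(\<lambda>n. energy (s n) y) \<longlonglongrightarrow> energy x y" if y: "y \<in> D" for y
  proof -
    have le: "cmod (energy (s n - x) y) \<le> sqrt (Re (energy (s n - x) (s n - x)) * Re (energy y y))" for n
      using energy.Cauchy_Schwarz[OF D_diff[OF sD xD] y, of n] by (rule real_le_rsqrt)
    have "(\<lambda>n. sqrt (Re (energy (s n - x) (s n - x)) * Re (energy y y))) \<longlonglongrightarrow> 0"
      using tendsto_real_sqrt[OF tendsto_mult_left_zero[OF elim]] by simp
    then have "(\<lambda>n. energy (s n - x) y) \<longlonglongrightarrow> 0"
      by (rule Lim_null_comparison[OF always_eventually[OF allI[OF le]]])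
    then show ?thesis
      using energy.diff_left[OF sD xD y] by (simp add: LIM_zero_iff)
  qed
  with xD x show ?thesis by (rule that)
qed

text \<open>The Riesz representation theorem for \<open>energy\<close> defines \<open>B\<close> by \<open>energy (B x) y = \<langle>x|y\<rangle>\<close>. For the
  operator \<open>T\<close> of the form, \<open>T x = z\<close> is equivalent to \<open>x = B (x + z)\<close>, so \<open>B = (1 + T)\<^sup>-\<^sup>1\<close>.\<close>

lemma resolvent:
  obtains B where "bounded_clinear B" "\<And>x y. cinner (B x) y = cinner x (B y)"
    "\<And>x. norm (B x) \<le> norm x" "\<And>x. norm (x - B x) \<le> norm x"
    "\<And>x. B x \<in> D" "\<And>x y. y \<in> D \<Longrightarrow> energy (B x) y = cinner x y" "\<And>x. B x = 0 \<Longrightarrow> x = 0"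
proof -
  have "\<exists>x\<in>D. \<forall>y\<in>D. energy x y = cinner w y" for w
  proof -
    have "(cmod (cinner w y))\<^sup>2 \<le> (norm w)\<^sup>2 * Re (energy y y)" if "y \<in> D" for y
      using power_mono[OF cinner_norm_le[of w y], of 2]
        mult_left_mono[OF norm_le_energy[OF that], of "(norm w)\<^sup>2"]
      by (simp add: power_mult_distrib)
    from energy.riesz_sequence[OF cinner_add_right cinner_scaleC_right this]
    obtain s where s: "\<And>n. s n \<in> D"
      "\<And>e. 0 < e \<Longrightarrow> \<exists>N. \<forall>m\<ge>N. \<forall>n\<ge>N. Re (energy (s m - s n) (s m - s n)) < e"
      "\<And>y. y \<in> D \<Longrightarrow> (\<lambda>n. energy (s n) y) \<longlonglongrightarrow> cinner w y"
      by blast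
    obtain x where x: "x \<in> D" "s \<longlonglongrightarrow> x"
      "\<And>y. y \<in> D \<Longrightarrow> (\<lambda>n. energy (s n) y) \<longlonglongrightarrow> energy x y"
      by (rule energy_complete[OF s(1)], erule s(2)) (rule that)
    have "energy x y = cinner w y" if "y \<in> D" for y
      by (rule LIMSEQ_unique[OF x(3)[OF that] s(3)[OF that]])
    with x(1) show ?thesis by blast
  qed
  then obtain B where BD: "\<And>w. B w \<in> D" and B: "\<And>w y. y \<in> D \<Longrightarrow> energy (B w) y = cinner w y"
    by metis
  have nB: "(norm (B w))\<^sup>2 \<le> Re (cinner w (B w))" for w
    using norm_le_energy[OF BD[of w]] B[OF BD, of w w] by simp
  have contr: "norm (B w) \<le> norm w" for w
  proof -
    have "norm (B w) * norm (B w) \<le> norm w * norm (B w)"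
      using nB[of w] complex_Re_le_cmod[of "cinner w (B w)"] cinner_norm_le[of w "B w"]
      by (simp add: power2_eq_square)
    then show ?thesis by (cases "B w = 0") auto
  qed
  show ?thesis
  proof
    show "B w \<in> D" "y \<in> D \<Longrightarrow> energy (B w) y = cinner w y" "norm (B w) \<le> norm w" for w y
      by fact+
    show "bounded_clinear B"
    proof (rule bounded_clinearI[where K = 1])
      show "B (x + y) = B x + B y" for x y
        by (rule energy_eqI) (auto simp: B BD energy.add_left cinner_simps D_add)
      show "B (c *\<^sub>C x) = c *\<^sub>C B x" for c x
        by (rule energy_eqI) (auto simp: B BD energy.scale_left cinner_simps D_scale)
      show "norm (B x) \<le> 1 * norm x" for x using contr by simp
    qed
    show "cinner (B x) y = cinner x (B y)" for x y
      using B[OF BD, of x y] B[OF BD, of y x] energy.symmetric[OF BD BD, of x y]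
        cinner_commute[of "B x" y] by simp
    show "norm (x - B x) \<le> norm x" for x
    proof -
      interpret hermitian_form UNIV "cinner :: 'a \<Rightarrow> _" by (rule hermitian_form_cinner) simp
      have "(norm (x - B x))\<^sup>2 \<le> (norm x)\<^sup>2"
        using expand_diff[OF UNIV_I UNIV_I, of x "B x"] nB[of x] zero_le_power2[of "norm (B x)"]
        unfolding cinner_self Re_complex_of_real by linarith
      then show ?thesis by (rule power2_le_imp_le) simp
    qed
    show "x = 0" if "B x = 0" for x
    proof (rule cinner_dense_eq[OF dense])
      show "cinner x y = cinner 0 y" if "y \<in> D" for y
        using B[OF that, of x] energy.scale_left[OF D_zero that, of 0] \<open>B x = 0\<close> by simp
    qed
  qed
qed

text \<open>\<open>T = B\<^sup>-\<^sup>1 - 1\<close> with \<open>B\<close> bounded, symmetric and injective: the pairs \<open>(B w, w - B w)\<close> form the graph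
  of \<open>T\<close>, and \<open>(u, v)\<close> belongs to the graph of the adjoint iff \<open>u = B (u + v)\<close>, which is the condition for
  the graph of \<open>T\<close> again.\<close>

lemma selfadjoint_form_op: "selfadjoint_operator (form_op D p)"
proof -
  obtain B where B: "bounded_clinear B" "\<And>x y. cinner (B x) y = cinner x (B y)"
    "\<And>x. B x \<in> D" "\<And>x y. y \<in> D \<Longrightarrow> energy (B x) y = cinner x y" "\<And>x. B x = 0 \<Longrightarrow> x = 0"
    using resolvent by metis
  let ?T = "form_op D p"
  note iff = form_op_eq_Some[OF dense]
  have T_iff: "?T x = Some z \<longleftrightarrow> x = B (x + z)" for x z
  proof
    assume "?T x = Some z"
    then have x: "x \<in> D" "\<forall>y\<in>D. p x y = cinner z y" by (auto simp: iff)
    show "x = B (x + z)"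
    proof (rule energy_eqI[OF x(1) B(3)])
      fix y assume "y \<in> D"
      with x show "energy x y = energy (B (x + z)) y"
        by (simp only: B(4)) (simp add: energy_def cinner_simps)
    qed
  next
    assume x: "x = B (x + z)"
    then have "x \<in> D" using B(3) by metis
    moreover have "p x y = cinner z y" if "y \<in> D" for y
      using B(4)[OF that, of "x + z"] x by (simp add: energy_def cinner_simps)
    ultimately show "?T x = Some z" by (simp add: iff)
  qed
  have TB: "?T (B w) = Some (w - B w)" for w
    by (simp add: T_iff)
  have domT: "dom ?T = range B"
  proof (intro set_eqI iffI)
    show "x \<in> range B" if "x \<in> dom ?T" for x
      using that T_iff by blast
    show "x \<in> dom ?T" if "x \<in> range B" for x
      using that TB by blast
  qed
  have dense': "closure (dom ?T) = UNIV"
    unfolding domT using B by (intro dense_range_of_injective_symmetric)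
  have "adjoint_operator ?T u = Some v \<longleftrightarrow> ?T u = Some v" for u v
  proof -
    have "adjoint_operator ?T u = Some v \<longleftrightarrow> (\<forall>w. cinner u (w - B w) = cinner v (B w))"
      unfolding adjoint_operator_eq_Some[OF dense'] domT by (simp add: TB)
    also have "\<dots> \<longleftrightarrow> (\<forall>w. cinner u w = cinner (B (u + v)) w)"
      by (simp add: B(2) cinner_simps algebra_simps)
    also have "\<dots> \<longleftrightarrow> u = B (u + v)"
      using cinner_dense_eq[of UNIV u "B (u + v)"] by auto
    finally show ?thesis by (simp add: T_iff)
  qed
  then have "adjoint_operator ?T = ?T"
    by (metis ext option.exhaust)
  with dense' show ?thesis by (rule selfadjoint_operatorI)
qed

lemma positive_form_op: "positive_operator (form_op D p)"
  unfolding positive_operator_def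
proof
  fix x assume "x \<in> dom (form_op D p)"
  then obtain z where z: "form_op D p x = Some z" by auto
  then have x: "x \<in> D" "p x x = cinner z x" by (auto simp: form_op_eq_Some[OF dense])
  then have "cinner x z = p x x" using cinner_commute[of x z] symmetric[of x x] by simp
  with z x nonneg[of x] diagonal[of x] show "cinner x (the (form_op D p x)) \<in> \<real>\<^sub>\<ge>\<^sub>0"
    by (simp add: complex_nonneg_Reals_iff)
qed

text \<open>With \<open>B = (1 + T)\<^sup>-\<^sup>1\<close>, \<open>R = \<surd>B\<close> and \<open>C = \<surd>(1 - B)\<close>, the root is \<open>C R\<^sup>-\<^sup>1\<close> on the range of \<open>R\<close>. That range is
  \<open>D\<close> because \<open>R\<close> is an isometry of the Hilbert space onto \<open>D\<close> with the inner product \<open>energy\<close>.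
  Selfadjointness follows from \<open>R C = C R\<close> and \<open>R\<^sup>2 + C\<^sup>2 = 1\<close>, and positivity from writing the
  product \<open>R C\<close> as \<open>Q C Q\<close> with \<open>Q = \<surd>R\<close>.\<close>

lemma form_sqrt:
  obtains S where "selfadjoint_operator S" "positive_operator S" "dom S = D"
    "\<And>x y. x \<in> D \<Longrightarrow> y \<in> D \<Longrightarrow> p x y = cinner (the (S x)) (the (S y))"
proof -
  obtain B where B: "bounded_clinear B" "\<And>x y. cinner (B x) y = cinner x (B y)"
    "\<And>x. norm (B x) \<le> norm x" "\<And>x. norm (x - B x) \<le> norm x"
    "\<And>x. B x \<in> D" "\<And>x y. y \<in> D \<Longrightarrow> energy (B x) y = cinner x y" "\<And>x. B x = 0 \<Longrightarrow> x = 0"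
    by (rule resolvent) (rule that)
  obtain R where R: "bounded_clinear R" "\<And>x y. cinner (R x) y = cinner x (R y)"
    "\<And>x. norm (x - R x) \<le> norm x" "\<And>x. R (R x) = B x"
    "\<forall>Z. bounded_clinear Z \<longrightarrow> (\<forall>x. Z (B x) = B (Z x)) \<longrightarrow> (\<forall>x. Z (R x) = R (Z x))"
    by (rule positive_sqrt[OF B(1,2,4)]) (rule that)
  have B': "bounded_clinear (\<lambda>x. x - B x)"
    using B(1,4) by (rule bounded_clinear_complement)
  have B'_symm: "cinner (x - B x) y = cinner x (y - B y)" for x y
    by (simp add: cinner_simps B(2))
  have B'_contr: "norm (x - (x - B x)) \<le> norm x" for x
    by (simp add: B(3))
  obtain C where C: "bounded_clinear C" "\<And>x y. cinner (C x) y = cinner x (C y)"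
    "\<And>x. norm (x - C x) \<le> norm x" "\<And>x. C (C x) = x - B x"
    and C_comm: "\<forall>Z. bounded_clinear Z \<longrightarrow> (\<forall>x. Z (x - B x) = Z x - B (Z x)) \<longrightarrow> (\<forall>x. Z (C x) = C (Z x))"
    by (rule positive_sqrt[OF B' B'_symm B'_contr]) (rule that)
  obtain Q where Q: "bounded_clinear Q" "\<And>x y. cinner (Q x) y = cinner x (Q y)"
    "\<And>x. norm (x - Q x) \<le> norm x" "\<And>x. Q (Q x) = R x"
    and Q_comm: "\<forall>Z. bounded_clinear Z \<longrightarrow> (\<forall>x. Z (R x) = R (Z x)) \<longrightarrow> (\<forall>x. Z (Q x) = Q (Z x))"
    by (rule positive_sqrt[OF R(1,2,3)]) (rule that)
  note Rl = bounded_clinearD[OF R(1)] and Cl = bounded_clinearD[OF C(1)]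
  have RC: "R (C x) = C (R x)" for x
    by (rule C_comm[rule_format, OF R(1)]) (simp add: Rl flip: R(4))
  have QC: "C (Q x) = Q (C x)" for x
    by (rule Q_comm[rule_format, OF C(1)]) (simp add: RC)
  have R_inj: "x = 0" if "R x = 0" for x
    using that B(7)[of x] by (simp add: Rl flip: R(4))
  then have inj: "inj R"
    by (metis Rl(3) eq_iff_diff_eq_0 injI)
  have R_dense: "closure (range R) = UNIV"
    using R(1,2) R_inj by (rule dense_range_of_injective_symmetric)
  \<comment> \<open>Write \<open>x\<close> as a limit of \<open>R (w n)\<close>. The vectors \<open>R (R (w n)) = B (w n)\<close> belong to \<open>D\<close> and are Cauchy in energy.\<close>
  have approx: "R x \<in> D \<and> (\<forall>y\<in>D. \<exists>w. (\<lambda>n. R (w n)) \<longlonglongrightarrow> x \<and> (\<lambda>n. energy (B (w n)) y) \<longlonglongrightarrow> energy (R x) y)" for x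
  proof -
    obtain u where u: "\<And>n. u n \<in> range R" "u \<longlonglongrightarrow> x"
      using R_dense closure_sequential[of x "range R"] by auto
    from u(1) have "\<forall>n. \<exists>v. u n = R v" by blast
    then obtain w where w: "\<And>n. u n = R (w n)" by metis
    have e: "Re (energy (B (w m) - B (w n)) (B (w m) - B (w n))) = (dist (u m) (u n))\<^sup>2" for m n
    proof -
      have "energy (B (w m) - B (w n)) (B (w m) - B (w n)) = cinner (w m - w n) (B (w m - w n))"
        using B(6)[OF B(5), of "w m - w n" "w m - w n"] by (simp add: bounded_clinearD[OF B(1)])
      also have "\<dots> = cinner (u m - u n) (u m - u n)"
        unfolding w Rl(3)[symmetric] R(2) R(4) ..
      finally show ?thesis by (simp add: cinner_self dist_norm)
    qed
    have "\<exists>N. \<forall>m\<ge>N. \<forall>n\<ge>N. Re (energy (B (w m) - B (w n)) (B (w m) - B (w n))) < e"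
      if e0: "0 < e" for e
    proof -
      obtain N where N: "\<forall>m\<ge>N. \<forall>n\<ge>N. dist (u m) (u n) < sqrt e"
        using metric_CauchyD[OF LIMSEQ_imp_Cauchy[OF u(2)], of "sqrt e"] e0 by auto
      have "(dist (u m) (u n))\<^sup>2 < e" if "m \<ge> N" "n \<ge> N" for m n
        using power_strict_mono[of "dist (u m) (u n)" "sqrt e" 2] N that e0 by simp
      then show ?thesis unfolding e by blast
    qed
    note cauchy = this
    obtain v where v: "v \<in> D" "(\<lambda>n. B (w n)) \<longlonglongrightarrow> v"
      "\<And>y. y \<in> D \<Longrightarrow> (\<lambda>n. energy (B (w n)) y) \<longlonglongrightarrow> energy v y"
      by (rule energy_complete[OF B(5)], erule cauchy) (rule that)
    have "(\<lambda>n. R (u n)) \<longlonglongrightarrow> R x"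
      using u(2) by (rule bounded_linear.tendsto[OF Rl(1)])
    then have "(\<lambda>n. B (w n)) \<longlonglongrightarrow> R x" by (simp add: w R(4))
    from LIMSEQ_unique[OF this v(2)] have v_eq: "v = R x" ..
    have "(\<lambda>n. R (w n)) \<longlonglongrightarrow> x" using u(2) by (simp add: w[symmetric])
    with v(1,3) show ?thesis unfolding v_eq by blast
  qed
  then have RD: "R x \<in> D" for x by blast
  have iso: "energy (R x) (R y) = cinner x y" for x y
  proof -
    obtain w where w: "(\<lambda>n. R (w n)) \<longlonglongrightarrow> x" "(\<lambda>n. energy (B (w n)) (R y)) \<longlonglongrightarrow> energy (R x) (R y)"
      using approx[of x] RD by blast
    have "(\<lambda>n. cinner (R (w n)) y) \<longlonglongrightarrow> cinner x y"
      using w(1) by (intro tendsto_cinner tendsto_const)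
    moreover have "energy (B (w n)) (R y) = cinner (R (w n)) y" for n
      by (simp add: B(6)[OF RD] R(2))
    ultimately show ?thesis using w(2) LIMSEQ_unique by fastforce
  qed
  \<comment> \<open>The functional \<open>R x \<mapsto> \<langle>y|x\<rangle>\<close> is bounded for \<open>y\<close> in \<open>D\<close>; a vector representing it is a preimage of \<open>y\<close>.\<close>
  have DR: "y \<in> range R" if y: "y \<in> D" for y
  proof -
    define l where "l u = cinner y (inv R u)" for u
    have l: "l (R x) = cinner y x" for x by (simp add: l_def inj)
    have "cmod (l (R x)) \<le> sqrt (Re (energy y y)) * norm (R x)" for x
    proof -
      have "(cmod (cinner x y))\<^sup>2 \<le> Re (energy (B x) (B x)) * Re (energy y y)"
        using energy.Cauchy_Schwarz[OF B(5) y, of x] by (simp add: B(6) y)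
      also have "Re (energy (B x) (B x)) = (norm (R x))\<^sup>2"
        using iso[of "R x" "R x"] by (simp add: R(4) cinner_self)
      finally have "cmod (cinner x y) \<le> sqrt ((norm (R x))\<^sup>2 * Re (energy y y))"
        by (rule real_le_rsqrt)
      moreover have "cmod (cinner x y) = cmod (l (R x))"
        using cinner_commute[of x y] by (simp add: l)
      ultimately show ?thesis by (simp add: real_sqrt_mult mult.commute)
    qed
    then have l_bound: "cmod (l u) \<le> sqrt (Re (energy y y)) * norm u" if "u \<in> range R" for u
      using that by blast
    have l_add: "l (u + v) = l u + l v" if "u \<in> range R" "v \<in> range R" for u v
      using that by (auto simp: l cinner_add_right simp flip: Rl(2))
    have l_scale: "l (c *\<^sub>C u) = c * l u" if "u \<in> range R" for c u
      using that by (auto simp: l cinner_scaleC_right simp flip: Rl(4))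
    obtain w where w: "\<And>u. u \<in> range R \<Longrightarrow> l u = cinner w u"
      using riesz_subspace[OF subspace_range[OF R(1)] l_add l_scale l_bound] by metis
    have "cinner y x = cinner (R w) x" for x
      using w[of "R x"] by (simp add: l R(2))
    then have "y = R w" using cinner_dense_eq[of UNIV y "R w"] by simp
    then show ?thesis by simp
  qed
  have D_eq: "D = range R" using RD DR by auto
  define S where "S = (\<lambda>u. if u \<in> D then Some (C (inv R u)) else None)"
  have SR: "S (R x) = Some (C x)" for x by (simp add: S_def RD inj)
  have domS: "dom S = D" by (auto simp: S_def split: if_splits)
  have "adjoint_operator S u = Some v \<longleftrightarrow> S u = Some v" for u v
  proof -
    have "adjoint_operator S u = Some v \<longleftrightarrow> (\<forall>x. cinner u (C x) = cinner v (R x))"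
      unfolding adjoint_operator_eq_Some[of S, unfolded domS, OF dense] unfolding D_eq by (simp add: SR)
    also have "\<dots> \<longleftrightarrow> (\<forall>x. cinner (C u) x = cinner (R v) x)"
      by (simp add: C(2) R(2))
    also have "\<dots> \<longleftrightarrow> C u = R v"
      using cinner_dense_eq[of UNIV "C u" "R v"] by auto
    also have "\<dots> \<longleftrightarrow> S u = Some v"
    proof
      assume eq: "C u = R v"
      \<comment> \<open>\<open>1 = R\<^sup>2 + C\<^sup>2\<close> exhibits \<open>u\<close> as an element of the range of \<open>R\<close>.\<close>
      have "u = R (R u) + C (C u)" by (simp add: C(4) R(4))
      also have "\<dots> = R (R u + C v)" by (simp add: eq RC Rl)
      finally have u: "u = R (R u + C v)" .
      have "C (R u + C v) = R (R v) + C (C v)" by (simp add: Cl eq flip: RC)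
      also have "\<dots> = v" by (simp add: C(4) R(4))
      finally show "S u = Some v" using SR[of "R u + C v"] u by simp
    next
      assume Suv: "S u = Some v"
      then obtain x where u: "u = R x" using domS D_eq by blast
      then have "v = C x" using Suv SR by simp
      with u show "C u = R v" by (simp add: RC)
    qed
    finally show ?thesis .
  qed
  then have "adjoint_operator S = S" by (metis ext option.exhaust)
  then have sa: "selfadjoint_operator S" using dense domS by (intro selfadjoint_operatorI) auto
  show ?thesis
  proof
    show "selfadjoint_operator S" by fact
    show "dom S = D" by fact
    show "positive_operator S"
      unfolding positive_operator_def
    proof
      fix u assume "u \<in> dom S"
      then obtain x where u: "u = R x" using domS D_eq by auto
      have eq: "cinner (R x) (C x) = cinner (Q x) (C (Q x))"
        by (simp add: Q(2) QC flip: Q(4))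
      have "cinner (Q x) (C (Q x)) = cnj (cinner (Q x) (C (Q x)))"
        using cinner_commute[of "Q x" "C (Q x)"] by (simp add: C(2))
      then have "Im (cinner (Q x) (C (Q x))) = 0" by (metis cnj.simps(2) equation_minus_iff neg_equal_zero)
      moreover have "0 \<le> Re (cinner (Q x) (C (Q x)))"
        using C(3) by (rule cinner_nonneg_of_contraction)
      ultimately show "cinner u (the (S u)) \<in> \<real>\<^sub>\<ge>\<^sub>0"
        by (simp add: u SR eq complex_nonneg_Reals_iff)
    qed
    show "p u v = cinner (the (S u)) (the (S v))" if uvD: "u \<in> D" "v \<in> D" for u v
    proof -
      obtain x y where uv: "u = R x" "v = R y" using uvD D_eq by auto
      have "cinner (C x) (C y) = cinner x (y - B y)" by (simp add: C)
      also have "\<dots> = energy (R x) (R y) - cinner (R x) (R y)"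
        by (simp add: iso cinner_diff_right R(2) R(4))
      also have "\<dots> = p (R x) (R y)" by (simp add: energy_def)
      finally show ?thesis by (simp add: uv SR)
    qed
  qed
qed

text \<open>A selfadjoint root \<open>S\<close> with form \<open>p\<close> forces \<open>T = S S = S\<^sup>*S\<close>, which \<open>adjoint_comp_self\<close> determines by \<open>p\<close>
  alone; \<open>form_sqrt\<close> supplies such a root.\<close>

lemma form_operator_iff: "form_operator D p T \<longleftrightarrow> T = form_op D p"
proof
  assume "form_operator D p T"
  then obtain S where S: "is_sqrt_operator S T" "dom S = D"
    "\<forall>x\<in>D. \<forall>y\<in>D. p x y = cinner (the (S x)) (the (S y))"
    unfolding form_operator_def by blast
  then have "T = adjoint_operator S \<circ>\<^sub>m S"
    by (auto simp: is_sqrt_operator_def selfadjoint_operator_def)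
  also have "\<dots> = form_op D p"
    using S by (intro adjoint_comp_self) auto
  finally show "T = form_op D p" .
next
  assume T: "T = form_op D p"
  obtain S where S: "selfadjoint_operator S" "positive_operator S" "dom S = D"
    "\<And>x y. x \<in> D \<Longrightarrow> y \<in> D \<Longrightarrow> p x y = cinner (the (S x)) (the (S y))"
    by (rule form_sqrt) (rule that)
  then have "S \<circ>\<^sub>m S = form_op D p"
    using adjoint_comp_self[of S D p] by (simp add: selfadjoint_operator_def)
  with S show "form_operator D p T"
    unfolding form_operator_def is_sqrt_operator_def T
    using selfadjoint_form_op positive_form_op by blast
qed

text \<open>Continuity of the antilinear functional \<open>y \<mapsto> p y x\<close> on the domain is the existence of a
  representing vector, by the Riesz representation theorem.\<close>

lemma continuous_iff_represented:
  assumes x: "x \<in> D"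
  shows "continuous_on D (\<lambda>y. p y x) \<longleftrightarrow> (\<exists>z. \<forall>y\<in>D. p x y = cinner z y)"
proof
  assume "\<exists>z. \<forall>y\<in>D. p x y = cinner z y"
  then obtain z where z: "\<And>y. y \<in> D \<Longrightarrow> p x y = cinner z y" by blast
  have eq: "p y x = cinner y z" if "y \<in> D" for y
    by (metis cinner_commute symmetric that x z)
  have "continuous_on D (\<lambda>y. cinner y z)"
    by (rule linear_continuous_on[OF bounded_bilinear.bounded_linear_left[OF bounded_bilinear_cinner]])
  then show "continuous_on D (\<lambda>y. p y x)"
    by (subst continuous_on_cong[OF refl eq])
next
  assume cont: "continuous_on D (\<lambda>y. p y x)"
  have p0: "p 0 x = 0" using scale_left[OF D_zero x, of 0] by simp
  obtain d where d: "d > 0" "\<And>y. y \<in> D \<Longrightarrow> norm y < d \<Longrightarrow> cmod (p y x) < 1"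
    using cont[unfolded continuous_on_iff, rule_format, OF D_zero zero_less_one] p0
    by (auto simp: dist_norm)
  have "cmod (p x y) \<le> (2 / d) * norm y" if y: "y \<in> D" for y
  proof (cases "y = 0")
    case True
    then show ?thesis using scale_right[OF x D_zero, of 0] by simp
  next
    case False
    define r where "r = d / (2 * norm y)"
    have r: "r > 0" using d False by (simp add: r_def)
    have "norm (complex_of_real r *\<^sub>C y) < d"
    proof -
      have "norm (complex_of_real r *\<^sub>C y) = r * norm y"
        using r by (simp add: norm_scaleC)
      also have "\<dots> = d / 2" using False by (simp add: r_def)
      finally show ?thesis using d by simp
    qed
    then have "cmod (p (complex_of_real r *\<^sub>C y) x) < 1" using d(2) y by blast
    then have "r * cmod (p y x) < 1" using r by (simp add: scale_left[OF y x] norm_mult)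
    moreover have "cmod (p y x) = cmod (p x y)" using symmetric[OF x y] by simp
    ultimately have "cmod (p x y) < 1 / r" using r by (simp add: field_simps)
    then show ?thesis using d False by (simp add: r_def field_simps)
  qed
  then show "\<exists>z. \<forall>y\<in>D. p x y = cinner z y"
    using riesz_subspace[OF subspace add_right[OF x] scale_right[OF x]] by metis
qed

lemma form_op_eq_weak:
  "form_op D p = (\<lambda>x. if x \<in> D \<and> continuous_on D (\<lambda>y. p y x)
     then Some (THE z. \<forall>y\<in>D. cinner y z = p y x) else None)"
proof
  fix x
  have "(\<forall>y\<in>D. cinner y z = p y x) \<longleftrightarrow> (\<forall>y\<in>D. p x y = cinner z y)" if "x \<in> D" for z
    by (metis cinner_commute symmetric that)
  then show "form_op D p x = (if x \<in> D \<and> continuous_on D (\<lambda>y. p y x)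
      then Some (THE z. \<forall>y\<in>D. cinner y z = p y x) else None)"
    by (simp add: form_op_def continuous_iff_represented cong: conj_cong)
qed

end

section \<open>Monotone limits of bounded forms\<close>

text \<open>What the form of a positive integrand inherits from the operators \<open>\<integral> t\<^sub>n dE\<close> of an increasing
  simple approximation is shared by all monotone limits of bounded positive forms.\<close>

locale increasing_forms =
  fixes G :: "nat \<Rightarrow> 'a::complex_inner \<Rightarrow> 'a" and D :: "'a set" and q :: "'a \<Rightarrow> 'a \<Rightarrow> complex"
  assumes clinear: "\<And>n. bounded_clinear (G n)"
    and symm: "\<And>n x y. cinner (G n x) y = cinner x (G n y)"
    and pos: "\<And>n x. 0 \<le> Re (cinner x (G n x))"
    and incr: "\<And>n x. Re (cinner x (G n x)) \<le> Re (cinner x (G (Suc n) x))"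
    and D_iff: "\<And>x. x \<in> D \<longleftrightarrow> (\<exists>C. \<forall>n. Re (cinner x (G n x)) \<le> C)"
    and lim: "\<And>x y. x \<in> D \<Longrightarrow> y \<in> D \<Longrightarrow> (\<lambda>n. cinner x (G n y)) \<longlonglongrightarrow> q x y"
begin

lemma form_G: "hermitian_form UNIV (\<lambda>x y. cinner x (G n y))"
proof
  show "cinner x (G n y) = cnj (cinner y (G n x))" for x y
    using cinner_commute[of x "G n y"] by (simp add: symm)
qed (simp_all add: bounded_clinearD[OF clinear] cinner_simps pos)

lemma subspace_D: "complex_vector.subspace D"
  unfolding complex_vector.subspace_def
proof (intro conjI ballI allI)
  show "0 \<in> D" by (auto simp: D_iff)
  fix x assume x: "x \<in> D"
  then obtain a where a: "\<And>n. Re (cinner x (G n x)) \<le> a" by (auto simp: D_iff)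
  show "c *\<^sub>C x \<in> D" for c
  proof -
    have "Re (cinner (c *\<^sub>C x) (G n (c *\<^sub>C x))) = (cmod c)\<^sup>2 * Re (cinner x (G n x))" for n
      using hermitian_form.diagonal_scale[OF form_G UNIV_I] .
    then show ?thesis
      unfolding D_iff using a by (auto intro!: exI[of _ "(cmod c)\<^sup>2 * a"] mult_left_mono)
  qed
  fix y assume "y \<in> D"
  then obtain b where b: "\<And>n. Re (cinner y (G n y)) \<le> b" by (auto simp: D_iff)
  \<comment> \<open>By the parallelogram law.\<close>
  have "Re (cinner (x + y) (G n (x + y))) \<le> 2 * a + 2 * b" for n
  proof -
    interpret hermitian_form UNIV "\<lambda>x y. cinner x (G n y)" by (rule form_G)
    show ?thesis
      using expand_add[OF UNIV_I UNIV_I, of x y] expand_diff[OF UNIV_I UNIV_I, of x y]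
        nonneg[OF UNIV_I, of "x - y"] a[of n] b[of n] by linarith
  qed
  then show "x + y \<in> D" unfolding D_iff by blast
qed

lemma hermitian: "hermitian_form D q"
proof
  note add = complex_vector.subspace_add[OF subspace_D]
    and scale = complex_vector.subspace_scale[OF subspace_D]
  show "complex_vector.subspace D" by (rule subspace_D)
  show "q x (y + z) = q x y + q x z" if "x \<in> D" "y \<in> D" "z \<in> D" for x y z
  proof (rule LIMSEQ_unique[OF lim])
    show "(\<lambda>n. cinner x (G n (y + z))) \<longlonglongrightarrow> q x y + q x z"
      unfolding bounded_clinearD(2)[OF clinear] cinner_add_right
      by (intro tendsto_add lim that)
  qed (use that add in auto)
  show "q x (c *\<^sub>C y) = c * q x y" if "x \<in> D" "y \<in> D" for x y c
  proof (rule LIMSEQ_unique[OF lim])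
    show "(\<lambda>n. cinner x (G n (c *\<^sub>C y))) \<longlonglongrightarrow> c * q x y"
      unfolding bounded_clinearD(4)[OF clinear] cinner_scaleC_right
      by (intro tendsto_mult tendsto_const lim that)
  qed (use that scale in auto)
  show "q x y = cnj (q y x)" if "x \<in> D" "y \<in> D" for x y
  proof (rule LIMSEQ_unique[OF lim])
    have "cinner x (G n y) = cnj (cinner y (G n x))" for n
      using cinner_commute[of x "G n y"] by (simp add: symm)
    then show "(\<lambda>n. cinner x (G n y)) \<longlonglongrightarrow> cnj (q y x)"
      using tendsto_cnj[OF lim[OF that(2,1)]] by simp
  qed (use that in auto)
  show "0 \<le> Re (q x x)" if "x \<in> D" for x
    using LIMSEQ_le_const[OF tendsto_Re[OF lim[OF that that]]] pos by blast
qed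

text \<open>The diagonal of the limit form is a supremum of continuous functions and hence lower
  semicontinuous, which is what closedness amounts to.\<close>

lemma closed: "closed_form D q"
  unfolding closed_form_def
proof (intro allI impI)
  fix s x assume sD: "\<forall>n. s n \<in> D" and sx: "s \<longlonglongrightarrow> x"
    and cauchy: "((\<lambda>(n, m). q (s n - s m) (s n - s m)) \<longlongrightarrow> 0) (sequentially \<times>\<^sub>F sequentially)"
  interpret hermitian_form D q by (rule hermitian)
  have below: "Re (cinner y (G n y)) \<le> Re (q y y)" if "y \<in> D" for y n
  proof (rule LIMSEQ_le_const[OF tendsto_Re[OF lim[OF that that]]])
    have "incseq (\<lambda>n. Re (cinner y (G n y)))" using incr by (rule incseq_SucI)
    then show "\<exists>N. \<forall>k\<ge>N. Re (cinner y (G n y)) \<le> Re (cinner y (G k y))"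
      by (meson incseqD)
  qed
  have tail: "\<exists>N. \<forall>k\<ge>N. s k - x \<in> D \<and> cmod (q (s k - x) (s k - x)) \<le> e" if "0 < e" for e
  proof -
    have "\<forall>\<^sub>F nm in sequentially \<times>\<^sub>F sequentially.
        dist (case nm of (n, m) \<Rightarrow> q (s n - s m) (s n - s m)) 0 < e"
      using cauchy \<open>0 < e\<close> by (rule tendstoD)
    then obtain N where N: "\<And>n m. n \<ge> N \<Longrightarrow> m \<ge> N \<Longrightarrow> cmod (q (s n - s m) (s n - s m)) < e"
      unfolding eventually_prod_sequentially by auto
    have "s k - x \<in> D \<and> cmod (q (s k - x) (s k - x)) \<le> e" if k: "k \<ge> N" for k
    proof -
      have le: "Re (cinner (s k - x) (G n (s k - x))) \<le> e" for n
      proof (rule LIMSEQ_le_const2)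
        show "(\<lambda>m. Re (cinner (s k - s m) (G n (s k - s m)))) \<longlonglongrightarrow> Re (cinner (s k - x) (G n (s k - x)))"
          by (intro tendsto_Re tendsto_cinner
              bounded_linear.tendsto[OF bounded_clinearD(1)[OF clinear]] tendsto_diff tendsto_const sx)
        have "Re (cinner (s k - s m) (G n (s k - s m))) \<le> e" if "m \<ge> N" for m
          using below[of "s k - s m" n] N[OF k that] complex_Re_le_cmod[of "q (s k - s m) (s k - s m)"]
            D_diff[of "s k" "s m"] sD by fastforce
        then show "\<exists>N. \<forall>m\<ge>N. Re (cinner (s k - s m) (G n (s k - s m))) \<le> e" by blast
      qed
      then have D: "s k - x \<in> D" unfolding D_iff by blast
      have "Re (q (s k - x) (s k - x)) \<le> e"
        using LIMSEQ_le_const2[OF tendsto_Re[OF lim[OF D D]]] le by blast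
      moreover have "cmod (q (s k - x) (s k - x)) = Re (q (s k - x) (s k - x))"
        using nonneg[OF D] diagonal[OF D] by (simp add: cmod_def)
      ultimately show ?thesis using D by simp
    qed
    then show ?thesis by blast
  qed
  obtain k where k: "s k - x \<in> D" using tail[of 1] by auto
  have "x \<in> D" using D_diff[of "s k" "s k - x"] sD k by simp
  then show "x \<in> D \<and> (\<lambda>n. q (s n - x) (s n - x)) \<longlonglongrightarrow> 0"
  proof (intro conjI LIMSEQ_I)
    fix r :: real assume "0 < r"
    then obtain N where "\<forall>k\<ge>N. cmod (q (s k - x) (s k - x)) \<le> r / 2"
      using tail[of "r / 2"] by auto
    then show "\<exists>no. \<forall>n\<ge>no. norm (q (s n - x) (s n - x) - 0) < r"
      using \<open>0 < r\<close> by (intro exI[of _ N]) force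
  qed simp
qed

end

section \<open>Jordan decomposition of signed measures\<close>

text \<open>Empty sets are admitted in the sequence, so that finite additivity is covered.\<close>

definition signed_additive :: "'w measure \<Rightarrow> ('w set \<Rightarrow> 'b::real_normed_vector) \<Rightarrow> bool" where
  "signed_additive M \<nu> \<longleftrightarrow> (\<forall>A. range A \<subseteq> sets M \<longrightarrow> disjoint_family A \<longrightarrow>
     (\<lambda>n::nat. \<nu> (A n)) sums \<nu> (\<Union>n. A n))"

lemma signed_additive_empty:
  assumes "signed_additive M \<nu>"
  shows "\<nu> {} = 0"
proof -
  have "(\<lambda>n::nat. \<nu> {}) sums \<nu> {}"
    using assms[unfolded signed_additive_def, rule_format, of "\<lambda>_. {}"]
    by (simp add: disjoint_family_on_def)
  then have "summable (\<lambda>n::nat. \<nu> {})" by (rule sums_summable)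
  then show ?thesis using summable_LIMSEQ_zero LIMSEQ_const_iff by blast
qed

lemma signed_additive_Un:
  assumes "signed_additive M \<nu>" "A \<in> sets M" "B \<in> sets M" "A \<inter> B = {}"
  shows "\<nu> (A \<union> B) = \<nu> A + \<nu> B"
proof -
  have "range (binaryset A B) \<subseteq> sets M" "disjoint_family (binaryset A B)"
    using assms by (auto simp: range_binaryset_eq disjoint_family_on_def binaryset_def)
  then have "(\<lambda>n. \<nu> (binaryset A B n)) sums \<nu> (A \<union> B)"
    using assms(1)[unfolded signed_additive_def, rule_format, of "binaryset A B"]
    by (simp add: UN_binaryset_eq)
  moreover have "(\<lambda>n. \<nu> (binaryset A B n)) sums (\<nu> A + \<nu> B)"
    by (rule binaryset_sums) (rule signed_additive_empty[OF assms(1)])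
  ultimately show ?thesis by (rule sums_unique2)
qed

lemma measure_of_nonneg:
  fixes m :: "'w set \<Rightarrow> real"
  assumes add: "signed_additive M m" and nn: "\<And>X. X \<in> sets M \<Longrightarrow> 0 \<le> m X"
  defines "N \<equiv> measure_of (space M) (sets M) (\<lambda>X. ennreal (m X))"
  shows "sets N = sets M" "space N = space M" "finite_measure N"
    "\<And>X. X \<in> sets M \<Longrightarrow> measure N X = m X"
proof -
  show s: "sets N = sets M" and sp: "space N = space M"
    by (auto simp: N_def sets.sigma_sets_eq space_measure_of_conv sets.space_closed)
  have em: "emeasure N X = ennreal (m X)" if "X \<in> sets M" for X
    unfolding N_def
  proof (rule emeasure_measure_of_sigma)
    show "sigma_algebra (space M) (sets M)" ..
    show "positive (sets M) (\<lambda>X. ennreal (m X))"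
      by (simp add: positive_def signed_additive_empty[OF add])
    show "countably_additive (sets M) (\<lambda>X. ennreal (m X))"
    proof (rule countably_additiveI)
      fix A :: "nat \<Rightarrow> 'w set" assume A: "range A \<subseteq> sets M" "disjoint_family A"
      then have "(\<lambda>n. m (A n)) sums m (\<Union>n. A n)" using add by (simp add: signed_additive_def)
      moreover have "0 \<le> m (A n)" for n using A nn by blast
      ultimately show "(\<Sum>n. ennreal (m (A n))) = ennreal (m (\<Union>n. A n))"
        by (intro suminf_ennreal_eq)
    qed
  qed (use that in auto)
  show "finite_measure N"
    by (rule finite_measureI) (simp add: sp em)
  show "measure N X = m X" if "X \<in> sets M" for X
    using em[OF that] nn[OF that] by (simp add: measure_def)
qed

lemma positive_variation_cong:
  assumes "\<And>X. X \<in> sets M \<Longrightarrow> \<nu> X = \<nu>' X"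
  shows "positive_variation M \<nu> = positive_variation M \<nu>'"
  unfolding positive_variation_def
  by (intro arg_cong2[where f = "measure_of (space M)"] ext refl SUP_cong) (use assms in auto)

text \<open>\<open>H\<close> carries the positive part of \<open>\<nu>\<close>, its complement the negative part.\<close>

locale hahn_decomposition =
  fixes M :: "'w measure" and \<nu> :: "'w set \<Rightarrow> real" and H :: "'w set"
  assumes additive: "signed_additive M \<nu>" and H: "H \<in> sets M"
    and nonneg: "\<And>X. X \<in> sets M \<Longrightarrow> X \<subseteq> H \<Longrightarrow> 0 \<le> \<nu> X"
    and nonpos: "\<And>X. X \<in> sets M \<Longrightarrow> X \<inter> H = {} \<Longrightarrow> \<nu> X \<le> 0"
begin

lemma uminus: "hahn_decomposition M (\<lambda>X. - \<nu> X) (space M - H)"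
proof
  show "signed_additive M (\<lambda>X. - \<nu> X)"
    using additive unfolding signed_additive_def by (auto intro: sums_minus)
  show "- \<nu> X \<le> 0" if X: "X \<in> sets M" "X \<inter> (space M - H) = {}" for X
    using nonneg[of X] X sets.sets_into_space[OF X(1)] by auto
qed (use H nonpos in auto)

lemma split:
  assumes X: "X \<in> sets M"
  shows "\<nu> X = \<nu> (X \<inter> H) + \<nu> (X - H)"
proof -
  have "\<nu> ((X \<inter> H) \<union> (X - H)) = \<nu> (X \<inter> H) + \<nu> (X - H)"
    using additive by (rule signed_additive_Un) (use X H in auto)
  then show ?thesis by (simp add: Int_Diff_Un)
qed

text \<open>The supremum over the measurable subsets of \<open>X\<close> is attained at \<open>X \<inter> H\<close>.\<close>

lemma positive_variation_eq:
  "positive_variation M \<nu> = measure_of (space M) (sets M) (\<lambda>X. ennreal (\<nu> (X \<inter> H)))"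
  unfolding positive_variation_def
proof (rule measure_of_eq)
  show "sets M \<subseteq> Pow (space M)" by (rule sets.space_closed)
  fix X assume "X \<in> sigma_sets (space M) (sets M)"
  then have X: "X \<in> sets M" by (simp add: sets.sigma_sets_eq)
  show "(SUP Y\<in>{Y \<in> sets M. Y \<subseteq> X}. ennreal (\<nu> Y)) = ennreal (\<nu> (X \<inter> H))"
  proof (rule antisym)
    show "(SUP Y\<in>{Y \<in> sets M. Y \<subseteq> X}. ennreal (\<nu> Y)) \<le> ennreal (\<nu> (X \<inter> H))"
    proof (rule SUP_least)
      fix Y assume "Y \<in> {Y \<in> sets M. Y \<subseteq> X}"
      then have Y: "Y \<in> sets M" "Y \<subseteq> X" by auto
      have "\<nu> ((Y \<inter> H) \<union> ((X - Y) \<inter> H)) = \<nu> (Y \<inter> H) + \<nu> ((X - Y) \<inter> H)"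
        using additive by (rule signed_additive_Un) (use X Y H in auto)
      moreover have "(Y \<inter> H) \<union> ((X - Y) \<inter> H) = X \<inter> H" using Y by auto
      moreover have "0 \<le> \<nu> ((X - Y) \<inter> H)" using X Y H by (intro nonneg) auto
      moreover have "\<nu> (Y - H) \<le> 0" using Y H by (intro nonpos) auto
      ultimately have "\<nu> Y \<le> \<nu> (X \<inter> H)" using split[OF Y(1)] by simp
      then show "ennreal (\<nu> Y) \<le> ennreal (\<nu> (X \<inter> H))" by (rule ennreal_leI)
    qed
    show "ennreal (\<nu> (X \<inter> H)) \<le> (SUP Y\<in>{Y \<in> sets M. Y \<subseteq> X}. ennreal (\<nu> Y))"
      using X H by (intro SUP_upper) auto
  qed
qed

lemma additive_Int: "signed_additive M (\<lambda>X. \<nu> (X \<inter> H))"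
  unfolding signed_additive_def
proof (intro allI impI)
  fix A :: "nat \<Rightarrow> 'w set" assume A: "range A \<subseteq> sets M" "disjoint_family A"
  then have "range (\<lambda>n. A n \<inter> H) \<subseteq> sets M" "disjoint_family (\<lambda>n. A n \<inter> H)"
    using H by (auto simp: disjoint_family_on_def)
  then have "(\<lambda>n. \<nu> (A n \<inter> H)) sums \<nu> (\<Union>n. A n \<inter> H)"
    using additive unfolding signed_additive_def by blast
  then show "(\<lambda>n. \<nu> (A n \<inter> H)) sums \<nu> ((\<Union>n. A n) \<inter> H)" by simp
qed

lemma
  shows sets_positive_variation: "sets (positive_variation M \<nu>) = sets M"
    and finite_positive_variation: "finite_measure (positive_variation M \<nu>)"
    and measure_positive_variation:
      "\<And>X. X \<in> sets M \<Longrightarrow> measure (positive_variation M \<nu>) X = \<nu> (X \<inter> H)"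
proof -
  have "0 \<le> \<nu> (X \<inter> H)" if "X \<in> sets M" for X using H that by (intro nonneg) auto
  note * = measure_of_nonneg[OF additive_Int this]
  show "sets (positive_variation M \<nu>) = sets M" "finite_measure (positive_variation M \<nu>)"
    "\<And>X. X \<in> sets M \<Longrightarrow> measure (positive_variation M \<nu>) X = \<nu> (X \<inter> H)"
    unfolding positive_variation_eq using * by simp_all
qed

end

lemma hahn_decomposition_exists:
  assumes fin: "finite_measure N1" "finite_measure N2" and s: "sets N1 = sets M" "sets N2 = sets M"
    and add: "signed_additive M \<nu>"
    and diff: "\<And>X. X \<in> sets M \<Longrightarrow> \<nu> X = measure N1 X - measure N2 X"
  obtains H where "hahn_decomposition M \<nu> H"
proof -
  interpret N1: finite_measure N1 by fact
  interpret N2: finite_measure N2 by fact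
  obtain Y where Y: "Y \<in> sets N1" "\<forall>X\<in>sets N1. X \<subseteq> Y \<longrightarrow> N2 X \<le> N1 X"
    "\<forall>X\<in>sets N1. X \<inter> Y = {} \<longrightarrow> N1 X \<le> N2 X"
    using finite_unsigned_Hahn_decomposition[OF fin] s by auto
  have "hahn_decomposition M \<nu> Y"
    by unfold_locales
      (use add Y in \<open>auto simp: s diff N1.emeasure_eq_measure N2.emeasure_eq_measure\<close>)
  then show ?thesis by (rule that)
qed

section \<open>Integrals of simple functions\<close>

abbreviation level_set :: "'w measure \<Rightarrow> ('w \<Rightarrow> real) \<Rightarrow> real \<Rightarrow> 'w set" where
  "level_set M s a \<equiv> s -` {a} \<inter> space M"

lemma simple_function_integral:
  fixes s :: "'w \<Rightarrow> real" and h :: "real \<Rightarrow> real"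
  assumes "finite_measure N" "sets N = sets M" and s: "simple_function M s"
  shows "integrable N (\<lambda>w. h (s w))"
    and "(LINT w|N. h (s w)) = (\<Sum>a\<in>s ` space M. h a * measure N (level_set M s a))"
proof -
  interpret finite_measure N by fact
  have sp: "space N = space M" using assms(2) by (rule sets_eq_imp_space_eq)
  have fin: "finite (s ` space M)" and lev: "level_set M s a \<in> sets N" for a
    using simple_functionD[OF s] assms(2) by auto
  have eq: "h (s w) = (\<Sum>a\<in>s ` space M. h a * indicator (level_set M s a) w)" if "w \<in> space N" for w
  proof -
    have "(\<Sum>a\<in>s ` space M. h a * indicator (level_set M s a) w)
        = (\<Sum>a\<in>s ` space M. if a = s w then h a else 0)"
      using that by (intro sum.cong refl) (auto simp: sp indicator_def)
    then show ?thesis using that fin by (simp add: sp)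
  qed
  have int: "integrable N (\<lambda>w. h a * indicator (level_set M s a) w)" for a
    using lev[of a] by (intro integrable_mult_right integrable_real_indicator) (auto simp: less_top[symmetric])
  have "has_bochner_integral N (\<lambda>w. \<Sum>a\<in>s ` space M. h a * indicator (level_set M s a) w)
      (\<Sum>a\<in>s ` space M. h a * measure N (level_set M s a))"
    using lev by (intro has_bochner_integral_sum has_bochner_integral_mult_right
      has_bochner_integral_real_indicator) (auto simp: less_top[symmetric])
  then have "has_bochner_integral N (\<lambda>w. h (s w)) (\<Sum>a\<in>s ` space M. h a * measure N (level_set M s a))"
    by (subst has_bochner_integral_cong[OF refl eq refl])
  then show "integrable N (\<lambda>w. h (s w))"
    "(LINT w|N. h (s w)) = (\<Sum>a\<in>s ` space M. h a * measure N (level_set M s a))"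
    by (auto simp: has_bochner_integral_iff)
qed

context hahn_decomposition
begin

lemma simple_integral_diff:
  assumes s: "simple_function M s"
  shows "(LINT w|positive_variation M \<nu>. s w) - (LINT w|positive_variation M (\<lambda>X. - \<nu> X). s w)
    = (\<Sum>a\<in>s ` space M. a * \<nu> (level_set M s a))"
proof -
  interpret neg: hahn_decomposition M "\<lambda>X. - \<nu> X" "space M - H" by (rule uminus)
  have lev: "level_set M s a \<in> sets M" for a using s by (rule simple_functionD)
  have "level_set M s a \<inter> (space M - H) = level_set M s a - H" for a by auto
  then show ?thesis
    using simple_function_integral(2)[OF finite_positive_variation sets_positive_variation s, of "\<lambda>a. a"]
      simple_function_integral(2)[OF neg.finite_positive_variation neg.sets_positive_variation s, of "\<lambda>a. a"]
    by (simp add: measure_positive_variation neg.measure_positive_variation lev split[OF lev]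
      algebra_simps flip: sum_subtractf)
qed

end

section \<open>Positive operator valued measures\<close>

lemma bounded_clinear_polarization:
  assumes "bounded_clinear T"
  shows "4 * cinner x (T y) = cinner (x + y) (T (x + y)) - cinner (x - y) (T (x - y))
    - \<i> * cinner (x + \<i> *\<^sub>C y) (T (x + \<i> *\<^sub>C y)) + \<i> * cinner (x - \<i> *\<^sub>C y) (T (x - \<i> *\<^sub>C y))"
  by (simp add: bounded_clinearD[OF assms] cinner_simps algebra_simps)

lemma bounded_clinear_eqI:
  assumes "bounded_clinear S" "bounded_clinear T" "\<And>x. cinner x (S x) = cinner x (T x)"
  shows "S x = T x"
proof (rule cinner_dense_eq_right[where D = UNIV])
  show "cinner y (S x) = cinner y (T x)" for y
  proof -
    have "4 * cinner y (S x) = 4 * cinner y (T x)"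
      unfolding bounded_clinear_polarization[OF assms(1)] bounded_clinear_polarization[OF assms(2)]
        assms(3) ..
    then show ?thesis by simp
  qed
qed simp

text \<open>Over the complex numbers a real diagonal suffices; the vectors \<open>x + y\<close> and \<open>x + \<i> y\<close> test the
  real and the imaginary part.\<close>

lemma positive_symmetric:
  assumes T: "bounded_clinear T" and real: "\<And>x. Im (cinner x (T x)) = 0"
  shows "cinner (T x) y = cinner x (T y)"
proof -
  define a b where "a = cinner x (T y)" and "b = cinner y (T x)"
  have "Im (cinner (x + y) (T (x + y))) = Im a + Im b"
    by (simp add: bounded_clinearD[OF T] cinner_simps real a_def b_def)
  moreover have "Im (cinner (x + \<i> *\<^sub>C y) (T (x + \<i> *\<^sub>C y))) = Re a - Re b"
    by (simp add: bounded_clinearD[OF T] cinner_simps real a_def b_def)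
  ultimately have "a = cnj b" by (simp add: real complex_eq_iff)
  then show ?thesis using cinner_commute[of "T x" y] by (simp add: a_def b_def)
qed

locale povm_space =
  fixes M :: "'w measure" and E :: "'w set \<Rightarrow> 'h::complex_inner \<Rightarrow> 'h"
  assumes povm: "povm M E"
begin

lemma clinear: "X \<in> sets M \<Longrightarrow> bounded_clinear (E X)"
  using povm by (simp add: povm_def)

lemma pos: "X \<in> sets M \<Longrightarrow> 0 \<le> Re (cinner x (E X x))"
  and real: "X \<in> sets M \<Longrightarrow> Im (cinner x (E X x)) = 0"
  using povm by (simp_all add: povm_def complex_nonneg_Reals_iff)

lemma symm: "X \<in> sets M \<Longrightarrow> cinner (E X x) y = cinner x (E X y)"
  using clinear real by (rule positive_symmetric)

lemma additive: "signed_additive M (\<lambda>X. E X x)"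
  using povm by (simp add: povm_def signed_additive_def)

lemma hermitian: "X \<in> sets M \<Longrightarrow> hermitian_form UNIV (\<lambda>x y. cinner x (E X y))"
proof
  show "cinner x (E X y) = cnj (cinner y (E X x))" if "X \<in> sets M" for x y
    using cinner_commute[of x "E X y"] by (simp add: symm[OF that])
qed (simp_all add: bounded_clinearD[OF clinear] cinner_simps pos)

text \<open>The factors \<open>c = 1, -1, -\<i>, \<i>\<close> select \<open>Re\<close>, \<open>-Re\<close>, \<open>Im\<close> and \<open>-Im\<close> of \<open>E\<^bsub>x,y\<^esub>\<close>, so that its four Jordan parts
  are treated together.\<close>

lemma additive_matrix: "signed_additive M (\<lambda>X. Re (c * cinner x (E X y)))"
  unfolding signed_additive_def
proof (intro allI impI)
  fix A :: "nat \<Rightarrow> 'w set" assume "range A \<subseteq> sets M" "disjoint_family A"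
  then have "(\<lambda>n. E (A n) y) sums E (\<Union>n. A n) y"
    using additive unfolding signed_additive_def by blast
  moreover have "bounded_linear (\<lambda>z. Re (c * cinner x z))"
    by (intro bounded_linear_compose[OF bounded_linear_Re]
        bounded_linear_compose[OF bounded_linear_mult_right]
        bounded_bilinear.bounded_linear_right[OF bounded_bilinear_cinner])
  ultimately show "(\<lambda>n. Re (c * cinner x (E (A n) y))) sums Re (c * cinner x (E (\<Union>n. A n) y))"
    using bounded_linear.sums by blast
qed

lemma
  shows sets_diagonal [simp]: "sets (diagonal_measure M E x) = sets M"
    and space_diagonal [simp]: "space (diagonal_measure M E x) = space M"
    and finite_diagonal: "finite_measure (diagonal_measure M E x)"
    and measure_diagonal: "X \<in> sets M \<Longrightarrow> measure (diagonal_measure M E x) X = Re (cinner x (E X x))"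
  unfolding diagonal_measure_def
  using measure_of_nonneg[OF additive_matrix[of 1 x x, simplified] pos] by auto

text \<open>By polarization, the signed measure is the difference of the diagonal measures of
  \<open>(x + c y) / 2\<close> and \<open>(x - c y) / 2\<close>.\<close>

lemma hahn_exists:
  obtains H where "hahn_decomposition M (\<lambda>X. Re (c * cinner x (E X y))) H"
proof -
  let ?N = "\<lambda>z. diagonal_measure M E ((1/2) *\<^sub>R z)"
  have "Re (c * cinner x (E X y)) = measure (?N (x + c *\<^sub>C y)) X - measure (?N (x - c *\<^sub>C y)) X"
    if X: "X \<in> sets M" for X
  proof -
    interpret hermitian_form UNIV "\<lambda>x y. cinner x (E X y)" using X by (rule hermitian)
    have half: "Re (cinner ((1/2) *\<^sub>R z) (E X ((1/2) *\<^sub>R z))) = Re (cinner z (E X z)) / 4" for z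
      by (simp add: bounded_clinearD[OF clinear[OF X]] cinner_simps)
    have quarter: "(p + 2 * r + q) / 4 - (p + 2 * - r + q) / 4 = r" for p q r :: real
      by (simp add: field_simps)
    have "x + (- c) *\<^sub>C y = x - c *\<^sub>C y" "Re (- c * z) = - Re (c * z)" for z
      by (simp_all add: complex_vector.scale_minus_left)
    then show ?thesis
      using expand_scale[OF UNIV_I UNIV_I, of x c y] expand_scale[OF UNIV_I UNIV_I, of x "-c" y]
      unfolding measure_diagonal[OF X] half norm_minus_cancel by (simp only: quarter)
  qed
  from hahn_decomposition_exists[OF finite_diagonal finite_diagonal _ _ additive_matrix this]
  show ?thesis using that by auto
qed

text \<open>The operator \<open>\<integral> s dE\<close> of a simple function.\<close>

definition simple_op :: "('w \<Rightarrow> real) \<Rightarrow> 'h \<Rightarrow> 'h" where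
  "simple_op s x = (\<Sum>a\<in>s ` space M. a *\<^sub>R E (level_set M s a) x)"

lemma level [simp]: "simple_function M s \<Longrightarrow> level_set M s a \<in> sets M"
  by (rule simple_functionD)

lemma bounded_clinear_sum:
  assumes "\<And>a. a \<in> A \<Longrightarrow> bounded_clinear (T a :: 'h \<Rightarrow> 'h)"
  shows "bounded_clinear (\<lambda>x. \<Sum>a\<in>A. (h a :: real) *\<^sub>R T a x)"
proof -
  have "bounded_linear (\<lambda>x. \<Sum>a\<in>A. h a *\<^sub>R T a x)"
    by (intro bounded_linear_sum bounded_linear_compose[OF bounded_linear_scaleR_right]
      bounded_clinearD(1)[OF assms])
  moreover have "(\<Sum>a\<in>A. h a *\<^sub>R T a (c *\<^sub>C x)) = c *\<^sub>C (\<Sum>a\<in>A. h a *\<^sub>R T a x)" for c x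
    by (simp add: complex_vector.scale_sum_right bounded_clinearD(4)[OF assms] scaleR_scaleC
      scaleC_scaleC mult.commute)
  ultimately show ?thesis by (simp add: bounded_clinear_def)
qed

lemma simple_op_clinear: "simple_function M s \<Longrightarrow> bounded_clinear (simple_op s)"
  unfolding simple_op_def by (intro bounded_clinear_sum clinear level)

lemma cinner_sum_level:
  "cinner x (\<Sum>a\<in>s ` space M. h a *\<^sub>R E (level_set M s a) y)
    = (\<Sum>a\<in>s ` space M. of_real (h a) * cinner x (E (level_set M s a) y))"
  by (simp add: cinner_sum_right cinner_scaleR_right)

lemma diagonal_integral:
  assumes s: "simple_function M s"
  shows "cinner x (\<Sum>a\<in>s ` space M. h a *\<^sub>R E (level_set M s a) x)
    = of_real (LINT w|diagonal_measure M E x. h (s w))"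
  unfolding cinner_sum_level simple_function_integral(2)[OF finite_diagonal sets_diagonal s]
  using s real[OF level[OF s]] by (simp add: measure_diagonal complex_eq_iff)

lemma simple_op_diagonal:
  "simple_function M s \<Longrightarrow> cinner x (simple_op s x) = of_real (LINT w|diagonal_measure M E x. s w)"
  unfolding simple_op_def by (rule diagonal_integral)

lemma simple_op_symm: "simple_function M s \<Longrightarrow> cinner (simple_op s x) y = cinner x (simple_op s y)"
  by (rule positive_symmetric) (simp_all add: simple_op_clinear simple_op_diagonal)

text \<open>Composition with \<open>h\<close> may merge level sets. Both operators have the integral of \<open>h (s w)\<close> as their
  diagonal, which determines them.\<close>

lemma simple_op_compose:
  assumes s: "simple_function M s"
  shows "simple_op (\<lambda>w. h (s w)) x = (\<Sum>a\<in>s ` space M. h a *\<^sub>R E (level_set M s a) x)"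
proof (rule bounded_clinear_eqI[where S = "simple_op (\<lambda>w. h (s w))"
    and T = "\<lambda>x. \<Sum>a\<in>s ` space M. h a *\<^sub>R E (level_set M s a) x"])
  have hs: "simple_function M (\<lambda>w. h (s w))" using s by (rule simple_function_compose1)
  then show "bounded_clinear (simple_op (\<lambda>w. h (s w)))" by (rule simple_op_clinear)
  show "bounded_clinear (\<lambda>x. \<Sum>a\<in>s ` space M. h a *\<^sub>R E (level_set M s a) x)"
    using s by (intro bounded_clinear_sum clinear level)
  show "cinner x (simple_op (\<lambda>w. h (s w)) x) = cinner x (\<Sum>a\<in>s ` space M. h a *\<^sub>R E (level_set M s a) x)" for x
    by (simp only: simple_op_diagonal[OF hs] diagonal_integral[OF s])
qed

lemma simple_op_diff:
  assumes "simple_function M s" "simple_function M t"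
  shows "simple_op (\<lambda>w. s w - t w) x = simple_op s x - simple_op t x"
proof (rule bounded_clinear_eqI[where S = "simple_op (\<lambda>w. s w - t w)"
    and T = "\<lambda>x. simple_op s x - simple_op t x"])
  have st: "simple_function M (\<lambda>w. s w - t w)" using assms by (rule simple_function_diff)
  then show "bounded_clinear (simple_op (\<lambda>w. s w - t w))" by (rule simple_op_clinear)
  note int = simple_function_integral(1)[OF finite_diagonal sets_diagonal, of _ _ "\<lambda>a. a"]
  show "bounded_clinear (\<lambda>x. simple_op s x - simple_op t x)"
    using simple_op_clinear[OF assms(1)] simple_op_clinear[OF assms(2)]
    by (auto simp: bounded_clinear_def bounded_linear_sub complex_vector.scale_right_diff_distrib)
  show "cinner x (simple_op (\<lambda>w. s w - t w) x) = cinner x (simple_op s x - simple_op t x)" for x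
    by (simp add: cinner_diff_right simple_op_diagonal assms st int)
qed

text \<open>The inequality \<open>2 Re \<langle>u|G v\<rangle> \<le> \<langle>u|G u\<rangle> + \<langle>v|G v\<rangle>\<close> on each level set, with \<open>u = p a x\<close> and
  \<open>v = r a c y\<close>. The factorization \<open>a = p a * r a\<close> distributes the integrand over the two vectors: it is
  split evenly when both are in the domain of the form, and put on one vector entirely for the spectral
  integral.\<close>

lemma positive_variation_integral_bound:
  fixes s :: "'w \<Rightarrow> real" and p r :: "real \<Rightarrow> real"
  assumes s: "simple_function M s" and c: "cmod c = 1"
    and pr: "\<And>a. a \<in> s ` space M \<Longrightarrow> a = p a * r a"
  shows "(LINT w|positive_variation M (\<lambda>X. Re (c * cinner x (E X y))). s w)
    \<le> ((LINT w|diagonal_measure M E x. (p (s w))\<^sup>2) + (LINT w|diagonal_measure M E y. (r (s w))\<^sup>2)) / 2"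
proof -
  obtain H where "hahn_decomposition M (\<lambda>X. Re (c * cinner x (E X y))) H" by (rule hahn_exists)
  then interpret hahn_decomposition M "\<lambda>X. Re (c * cinner x (E X y))" H .
  have term_bound: "a * Re (c * cinner x (E (A \<inter> H) y))
      \<le> ((p a)\<^sup>2 * Re (cinner x (E A x)) + (r a)\<^sup>2 * Re (cinner y (E A y))) / 2"
    if A: "A \<in> sets M" and a: "a \<in> s ` space M" for A and a :: real
  proof -
    have AH: "A \<inter> H \<in> sets M" using A H by auto
    interpret hermitian_form UNIV "\<lambda>x y. cinner x (E (A \<inter> H) y)" using AH by (rule hermitian)
    have mono: "Re (cinner z (E (A \<inter> H) z)) \<le> Re (cinner z (E A z))" for z
    proof -
      interpret finite_measure "diagonal_measure M E z" by (rule finite_diagonal)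
      have "measure (diagonal_measure M E z) (A \<inter> H) \<le> measure (diagonal_measure M E z) A"
        using A by (intro finite_measure_mono) auto
      then show ?thesis using A AH by (simp add: measure_diagonal)
    qed
    let ?u = "complex_of_real (p a) *\<^sub>C x" and ?v = "(complex_of_real (r a) * c) *\<^sub>C y"
    have "cinner ?u (E (A \<inter> H) ?v) = of_real a * (c * cinner x (E (A \<inter> H) y))"
      by (subst (3) pr[OF a]) (simp add: bounded_clinearD[OF clinear[OF AH]] cinner_simps)
    then have e1: "Re (cinner ?u (E (A \<inter> H) ?v)) = a * Re (c * cinner x (E (A \<inter> H) y))" by simp
    have "2 * Re (cinner ?u (E (A \<inter> H) ?v))
        \<le> Re (cinner ?u (E (A \<inter> H) ?u)) + Re (cinner ?v (E (A \<inter> H) ?v))"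
      using expand_diff[OF UNIV_I UNIV_I, of ?u ?v] nonneg[OF UNIV_I, of "?u - ?v"] by linarith
    also have "\<dots> = (p a)\<^sup>2 * Re (cinner x (E (A \<inter> H) x)) + (r a)\<^sup>2 * Re (cinner y (E (A \<inter> H) y))"
      unfolding diagonal_scale[OF UNIV_I] by (simp add: norm_mult c)
    also have "\<dots> \<le> (p a)\<^sup>2 * Re (cinner x (E A x)) + (r a)\<^sup>2 * Re (cinner y (E A y))"
      by (intro add_mono mult_left_mono mono) auto
    finally show ?thesis unfolding e1 by simp
  qed
  have "(LINT w|positive_variation M (\<lambda>X. Re (c * cinner x (E X y))). s w)
      = (\<Sum>a\<in>s ` space M. a * Re (c * cinner x (E (level_set M s a \<inter> H) y)))"
    using simple_function_integral(2)[OF finite_positive_variation sets_positive_variation s, of "\<lambda>a. a"]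
    by (simp only: measure_positive_variation[OF level[OF s]])
  also have "\<dots> \<le> (\<Sum>a\<in>s ` space M. ((p a)\<^sup>2 * Re (cinner x (E (level_set M s a) x))
      + (r a)\<^sup>2 * Re (cinner y (E (level_set M s a) y))) / 2)"
    using s by (intro sum_mono term_bound) auto
  also have "\<dots> = ((\<Sum>a\<in>s ` space M. (p a)\<^sup>2 * Re (cinner x (E (level_set M s a) x)))
      + (\<Sum>a\<in>s ` space M. (r a)\<^sup>2 * Re (cinner y (E (level_set M s a) y)))) / 2"
    by (simp add: sum.distrib sum_divide_distrib add_divide_distrib)
  also have "\<dots> = ((LINT w|diagonal_measure M E x. (p (s w))\<^sup>2) + (LINT w|diagonal_measure M E y. (r (s w))\<^sup>2)) / 2"
    using s simple_function_integral(2)[OF finite_diagonal sets_diagonal s, of x "\<lambda>a. (p a)\<^sup>2"]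
      simple_function_integral(2)[OF finite_diagonal sets_diagonal s, of y "\<lambda>a. (r a)\<^sup>2"]
    by (simp add: measure_diagonal)
  finally show ?thesis .
qed

end

section \<open>Approximation by simple functions\<close>

locale simple_approx =
  fixes M :: "'w measure" and t :: "nat \<Rightarrow> 'w \<Rightarrow> real" and g :: "'w \<Rightarrow> real"
  assumes simple: "\<And>n. simple_function M (t n)"
    and t_nonneg: "\<And>n w. 0 \<le> t n w"
    and t_mono: "\<And>n w. t n w \<le> t (Suc n) w"
    and t_lim: "\<And>w. w \<in> space M \<Longrightarrow> (\<lambda>n. t n w) \<longlonglongrightarrow> g w"
begin

lemma g_measurable: "g \<in> borel_measurable M"
  using t_lim borel_measurable_simple_function[OF simple] by (rule borel_measurable_LIMSEQ_real)

lemma t_incseq: "incseq (\<lambda>n. t n w)"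
  using t_mono by (rule incseq_SucI)

lemma t_le: "w \<in> space M \<Longrightarrow> t n w \<le> g w"
  using incseq_le[OF t_incseq t_lim] .

lemma square: "simple_approx M (\<lambda>n w. (t n w)\<^sup>2) (\<lambda>w. (g w)\<^sup>2)"
proof
  show "simple_function M (\<lambda>w. (t n w)\<^sup>2)" for n
    using simple by (rule simple_function_compose1)
  show "(\<lambda>n. (t n w)\<^sup>2) \<longlonglongrightarrow> (g w)\<^sup>2" if "w \<in> space M" for w
    using t_lim[OF that] by (rule tendsto_power)
qed (auto intro: power_mono t_mono t_nonneg)

lemma integrable_simple:
  "finite_measure N \<Longrightarrow> sets N = sets M \<Longrightarrow> integrable N (t n)"
  using simple_function_integral(1)[OF _ _ simple, of N "\<lambda>a. a"] by simp

lemma integral_mono_Suc: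
  assumes "finite_measure N" "sets N = sets M"
  shows "(LINT w|N. t n w) \<le> (LINT w|N. t (Suc n) w)"
  using integrable_simple[OF assms] t_mono by (intro integral_mono) auto

lemma integrable_limit:
  assumes N: "finite_measure N" "sets N = sets M" and bd: "\<exists>C. \<forall>n. (LINT w|N. t n w) \<le> C"
  shows "integrable N g" and "(\<lambda>n. LINT w|N. t n w) \<longlonglongrightarrow> (LINT w|N. g w)"
proof -
  have sp: "space N = space M" using N(2) by (rule sets_eq_imp_space_eq)
  have inc: "incseq (\<lambda>n. LINT w|N. t n w)"
    using integral_mono_Suc[OF N] by (rule incseq_SucI)
  obtain L where L: "(\<lambda>n. LINT w|N. t n w) \<longlonglongrightarrow> L"
    using bd incseq_convergent[OF inc] by blast
  have "AE w in N. mono (\<lambda>n. t n w)" "AE w in N. 0 \<le> t n w"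
    "AE w in N. (\<lambda>n. t n w) \<longlonglongrightarrow> g w" "g \<in> borel_measurable N" for n
    using t_nonneg t_incseq t_lim g_measurable by (auto simp: sp measurable_cong_sets[OF N(2) refl])
  note * = integral_monotone_convergence_nonneg[OF integrable_simple[OF N] this(1-3) L this(4)]
  show "integrable N g" by (rule *(1))
  show "(\<lambda>n. LINT w|N. t n w) \<longlonglongrightarrow> (LINT w|N. g w)" using L by (simp only: *(2))
qed

lemma integral_le:
  assumes N: "finite_measure N" "sets N = sets M" and "integrable N g"
  shows "(LINT w|N. t n w) \<le> (LINT w|N. g w)"
  using integrable_simple[OF N] assms(3) t_le
  by (intro integral_mono) (auto simp: sets_eq_imp_space_eq[OF N(2)])

end

lemma simple_approx_exists:
  fixes g :: "'w \<Rightarrow> real"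
  assumes g: "g \<in> borel_measurable M" "\<And>w. w \<in> space M \<Longrightarrow> 0 \<le> g w"
  obtains t where "simple_approx M t g"
proof -
  have "(\<lambda>w. max 0 (g w)) \<in> borel_measurable M" using g(1) by measurable
  from borel_measurable_implies_simple_function_sequence_real[OF this]
  obtain t where t: "incseq t" "\<forall>i. simple_function M (t i)" "\<forall>x. bdd_above (range (\<lambda>i. t i x))"
    "\<forall>i x. 0 \<le> t i x" and sup: "(\<lambda>w. max 0 (g w)) = (SUP i. t i)"
    by auto
  have "simple_approx M t g"
  proof
    show "simple_function M (t n)" "0 \<le> t n w" for n w using t by auto
    show "t n w \<le> t (Suc n) w" for n w using incseq_SucD[OF t(1)] by (simp add: le_fun_def)
    show "(\<lambda>n. t n w) \<longlonglongrightarrow> g w" if w: "w \<in> space M" for w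
    proof -
      have "(\<lambda>n. t n w) \<longlonglongrightarrow> (SUP n. t n w)"
        using t by (intro LIMSEQ_incseq_SUP) (auto simp: incseq_def le_fun_def)
      moreover have "(SUP n. t n w) = max 0 (g w)"
        using fun_cong[OF sup, of w] by (simp add: image_comp)
      ultimately show ?thesis using g(2)[OF w] by (simp add: max_def)
    qed
  qed
  then show ?thesis by (rule that)
qed

locale povm_approx = povm_space M E + simple_approx M t g
  for M :: "'w measure" and E :: "'w set \<Rightarrow> 'h::complex_inner \<Rightarrow> 'h" and t g
begin

text \<open>Monotone convergence in each of the four Jordan parts of \<open>E\<^bsub>x,y\<^esub>\<close>. For a simple function their
  integrals recombine to a matrix element of \<open>simple_op\<close>, since a Hahn set splits every level set into
  two parts.\<close>

lemma matrix_limit: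
  assumes f: "\<forall>w\<in>space M. f w = complex_of_real (g w)"
    and bound: "\<And>c. cmod c = 1 \<Longrightarrow>
      \<exists>C. \<forall>n. (LINT w|positive_variation M (\<lambda>X. Re (c * cinner x (E X y))). t n w) \<le> C"
  shows "(\<lambda>n. cinner x (simple_op (t n) y)) \<longlonglongrightarrow> integral_form M f E x y"
proof -
  define P where "P c = positive_variation M (\<lambda>X. Re (c * cinner x (E X y)))" for c
  have P: "finite_measure (P c)" "sets (P c) = sets M" for c
  proof -
    obtain H where "hahn_decomposition M (\<lambda>X. Re (c * cinner x (E X y))) H" by (rule hahn_exists)
    then interpret hahn_decomposition M "\<lambda>X. Re (c * cinner x (E X y))" H .
    show "finite_measure (P c)" "sets (P c) = sets M"
      unfolding P_def by (rule finite_positive_variation sets_positive_variation)+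
  qed
  have lim: "(\<lambda>n. LINT w|P c. t n w) \<longlonglongrightarrow> (LINT w|P c. g w)" if "cmod c = 1" for c
    using integrable_limit(2)[OF P, of c] bound[OF that] by (simp only: P_def)
  have f_int: "(LINT w|P c. f w) = of_real (LINT w|P c. g w)" for c
  proof -
    have "(LINT w|P c. f w) = (LINT w|P c. complex_of_real (g w))"
      using f by (intro Bochner_Integration.integral_cong) (auto simp: sets_eq_imp_space_eq[OF P(2)])
    then show ?thesis by simp
  qed
  have part: "Re (c * cinner x (simple_op (t n) y)) = (LINT w|P c. t n w) - (LINT w|P (- c). t n w)" for c n
  proof -
    obtain H where "hahn_decomposition M (\<lambda>X. Re (c * cinner x (E X y))) H" by (rule hahn_exists)
    then interpret hahn_decomposition M "\<lambda>X. Re (c * cinner x (E X y))" H .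
    have "P (- c) = positive_variation M (\<lambda>X. - Re (c * cinner x (E X y)))"
      unfolding P_def by simp
    then have "(LINT w|P c. t n w) - (LINT w|P (- c). t n w)
        = (\<Sum>a\<in>t n ` space M. a * Re (c * cinner x (E (level_set M (t n) a) y)))"
      using simple_integral_diff[OF simple, of n] by (simp only: P_def)
    also have "\<dots> = Re (c * cinner x (simple_op (t n) y))"
      by (simp add: simple_op_def cinner_sum_level sum_distrib_left Re_sum algebra_simps)
    finally show ?thesis ..
  qed
  have "(\<lambda>n. of_real (Re (1 * cinner x (simple_op (t n) y))) + \<i> * of_real (Re (- \<i> * cinner x (simple_op (t n) y))))
    \<longlonglongrightarrow> of_real ((LINT w|P 1. g w) - (LINT w|P (- 1). g w))
      + \<i> * of_real ((LINT w|P (- \<i>). g w) - (LINT w|P (- (- \<i>)). g w))"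
    unfolding part by (intro tendsto_intros lim) auto
  moreover have "of_real (Re (1 * z)) + \<i> * of_real (Re (- \<i> * z)) = z" for z
    by (simp add: complex_eq_iff)
  moreover have "integral_form M f E x y = of_real ((LINT w|P 1. g w) - (LINT w|P (- 1). g w))
      + \<i> * of_real ((LINT w|P (- \<i>). g w) - (LINT w|P (- (- \<i>)). g w))"
  proof -
    have Ps: "P 1 = positive_variation M (\<lambda>X. Re (cinner x (E X y)))"
      "P (- 1) = positive_variation M (\<lambda>X. - Re (cinner x (E X y)))"
      "P (- \<i>) = positive_variation M (\<lambda>X. Im (cinner x (E X y)))"
      "P (- (- \<i>)) = positive_variation M (\<lambda>X. - Im (cinner x (E X y)))"
      by (simp_all add: P_def)
    show ?thesis
      unfolding integral_form_def cmeasure_integral_def of_real_diff f_int[symmetric] unfolding Ps ..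
  qed
  ultimately show ?thesis by simp
qed

lemma form_domain_iff:
  assumes f: "\<forall>w\<in>space M. f w = complex_of_real (g w)"
  shows "x \<in> form_domain M f E \<longleftrightarrow> integrable (diagonal_measure M E x) g"
proof -
  have "(\<integral>\<^sup>+w. ennreal (cmod (f w)) \<partial>diagonal_measure M E x)
      = (\<integral>\<^sup>+w. ennreal (norm (g w)) \<partial>diagonal_measure M E x)"
    using f by (intro nn_integral_cong) simp
  moreover have "g \<in> borel_measurable (diagonal_measure M E x)"
    using g_measurable by (simp add: measurable_cong_sets[OF sets_diagonal refl])
  ultimately show ?thesis
    by (simp add: form_domain_def integrable_iff_bounded)
qed

lemma form_domain_iff_bounded:
  assumes f: "\<forall>w\<in>space M. f w = complex_of_real (g w)"
  shows "x \<in> form_domain M f E \<longleftrightarrow> (\<exists>C. \<forall>n. Re (cinner x (simple_op (t n) x)) \<le> C)"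
proof -
  note fin = finite_diagonal[of x] sets_diagonal[of x]
  have "integrable (diagonal_measure M E x) g \<longleftrightarrow> (\<exists>C. \<forall>n. (LINT w|diagonal_measure M E x. t n w) \<le> C)"
    using integrable_limit(1)[OF fin] integral_le[OF fin] by blast
  then show ?thesis
    unfolding form_domain_iff[OF f] by (simp add: simple_op_diagonal simple)
qed

text \<open>The integrand is split evenly, \<open>t = \<surd>t \<surd>t\<close>, so that the bound is the mean of \<open>\<integral> g dE\<^bsub>x,x\<^esub>\<close> and \<open>\<integral> g dE\<^bsub>y,y\<^esub>\<close>.\<close>

lemma form_limit:
  assumes f: "\<forall>w\<in>space M. f w = complex_of_real (g w)"
    and xy: "x \<in> form_domain M f E" "y \<in> form_domain M f E"
  shows "(\<lambda>n. cinner x (simple_op (t n) y)) \<longlonglongrightarrow> integral_form M f E x y"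
proof (rule matrix_limit[OF f])
  fix c :: complex assume c: "cmod c = 1"
  have bd: "(LINT w|diagonal_measure M E z. (sqrt (t n w))\<^sup>2) \<le> (LINT w|diagonal_measure M E z. g w)"
    if "z \<in> form_domain M f E" for z n
    using integral_le[OF finite_diagonal sets_diagonal] that by (simp add: form_domain_iff[OF f] t_nonneg)
  have "(LINT w|positive_variation M (\<lambda>X. Re (c * cinner x (E X y))). t n w)
      \<le> ((LINT w|diagonal_measure M E x. g w) + (LINT w|diagonal_measure M E y. g w)) / 2" for n
  proof -
    have "(LINT w|positive_variation M (\<lambda>X. Re (c * cinner x (E X y))). t n w)
        \<le> ((LINT w|diagonal_measure M E x. (sqrt (t n w))\<^sup>2)
          + (LINT w|diagonal_measure M E y. (sqrt (t n w))\<^sup>2)) / 2"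
      by (rule positive_variation_integral_bound[OF simple c]) (auto simp: t_nonneg)
    also have "\<dots> \<le> ((LINT w|diagonal_measure M E x. g w) + (LINT w|diagonal_measure M E y. g w)) / 2"
      using bd[OF xy(1), of n] bd[OF xy(2), of n] by (intro divide_right_mono add_mono) auto
    finally show ?thesis .
  qed
  then show "\<exists>C. \<forall>n. (LINT w|positive_variation M (\<lambda>X. Re (c * cinner x (E X y))). t n w) \<le> C" by blast
qed

lemma increasing_forms:
  assumes f: "\<forall>w\<in>space M. f w = complex_of_real (g w)"
  shows "increasing_forms (\<lambda>n. simple_op (t n)) (form_domain M f E) (integral_form M f E)"
proof
  show "bounded_clinear (simple_op (t n))" for n using simple by (rule simple_op_clinear)
  show "cinner (simple_op (t n) x) y = cinner x (simple_op (t n) y)" for n x y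
    using simple by (rule simple_op_symm)
  show "0 \<le> Re (cinner x (simple_op (t n) x))" for n x
    using t_nonneg by (simp add: simple_op_diagonal simple)
  show "Re (cinner x (simple_op (t n) x)) \<le> Re (cinner x (simple_op (t (Suc n)) x))" for n x
    using integral_mono_Suc[OF finite_diagonal sets_diagonal] by (simp add: simple_op_diagonal simple)
qed (fact form_domain_iff_bounded[OF f] form_limit[OF f])+

end

section \<open>Spectral integrals\<close>

locale spectral_space = povm_space M F for M :: "'w measure" and F :: "'w set \<Rightarrow> 'k::chilbert_space \<Rightarrow> 'k" +
  assumes idem: "\<And>X x. X \<in> sets M \<Longrightarrow> F X (F X x) = F X x"
begin

text \<open>For \<open>y\<close> in the range of \<open>F B\<close>, the norm of \<open>F (A \<union> B) y\<close> is at most that of \<open>y\<close>, while its square is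
  \<open>\<parallel>F A y\<parallel>\<^sup>2 + \<parallel>y\<parallel>\<^sup>2\<close>.\<close>

lemma orthogonal:
  assumes A: "A \<in> sets M" and B: "B \<in> sets M" and AB: "A \<inter> B = {}"
  shows "F A (F B x) = 0"
proof -
  define y where "y = F B x"
  have By: "F B y = y" using idem[OF B] by (simp add: y_def)
  have self: "Re (cinner y (F X y)) = (norm (F X y))\<^sup>2" if "X \<in> sets M" for X
  proof -
    have "cinner y (F X y) = cinner (F X y) (F X y)" by (simp add: symm idem that)
    then show ?thesis by (simp only: cinner_self Re_complex_of_real)
  qed
  have "F (A \<union> B) y = F A y + F B y"
    using additive A B AB by (rule signed_additive_Un)
  then have "Re (cinner y (F (A \<union> B) y)) = (norm (F A y))\<^sup>2 + (norm y)\<^sup>2"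
    using self[OF A] self[OF B] by (simp add: cinner_add_right By)
  moreover have "(norm (F (A \<union> B) y))\<^sup>2 \<le> norm y * norm (F (A \<union> B) y)"
    using self[of "A \<union> B"] A B complex_Re_le_cmod[of "cinner y (F (A \<union> B) y)"]
      cinner_norm_le[of y "F (A \<union> B) y"] by simp
  then have "norm (F (A \<union> B) y) \<le> norm y"
    by (cases "F (A \<union> B) y = 0") (auto simp: power2_eq_square)
  then have "Re (cinner y (F (A \<union> B) y)) \<le> (norm y)\<^sup>2"
    using self[of "A \<union> B"] A B by (simp add: power_mono)
  ultimately have "(norm (F A y))\<^sup>2 \<le> 0" by simp
  then show ?thesis by (simp add: y_def)
qed

lemma simple_op_inner:
  assumes s: "simple_function M s"
  shows "cinner (simple_op s x) (simple_op s y) = cinner x (simple_op (\<lambda>w. (s w)\<^sup>2) y)"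
proof -
  have fin: "finite (s ` space M)" using s by (rule simple_functionD)
  have inner: "cinner (F (level_set M s a) x) (F (level_set M s b) y)
      = (if a = b then cinner x (F (level_set M s a) y) else 0)" for a b
  proof (cases "a = b")
    case False
    then have "level_set M s a \<inter> level_set M s b = {}" by auto
    then show ?thesis using False s by (simp add: symm orthogonal)
  qed (use s in \<open>simp add: symm idem\<close>)
  have "cinner (simple_op s x) (simple_op s y)
      = (\<Sum>a\<in>s ` space M. \<Sum>b\<in>s ` space M.
          if a = b then of_real a * of_real a * cinner x (F (level_set M s a) y) else 0)"
    unfolding simple_op_def cinner_sum_left cinner_sum_right cinner_scaleR_left cinner_scaleR_right inner
    by (intro sum.cong refl) (auto simp: sum_distrib_left intro!: sum.cong)
  also have "\<dots> = cinner x (simple_op (\<lambda>w. (s w)\<^sup>2) y)"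
    unfolding simple_op_compose[OF s, of "\<lambda>a. a\<^sup>2"] cinner_sum_level
    by (simp add: fin power2_eq_square)
  finally show ?thesis .
qed

lemma norm_simple_op:
  assumes s: "simple_function M s"
  shows "(norm (simple_op s x))\<^sup>2 = (LINT w|diagonal_measure M F x. (s w)\<^sup>2)"
proof -
  have s2: "simple_function M (\<lambda>w. (s w)\<^sup>2)" using s by (rule simple_function_compose1)
  have "complex_of_real ((norm (simple_op s x))\<^sup>2) = of_real (LINT w|diagonal_measure M F x. (s w)\<^sup>2)"
    unfolding cinner_self[symmetric] simple_op_inner[OF s] simple_op_diagonal[OF s2] ..
  then show ?thesis unfolding of_real_eq_iff .
qed

end

locale spectral_approx = spectral_space M F + simple_approx M t g
  for M :: "'w measure" and F :: "'w set \<Rightarrow> 'k::chilbert_space \<Rightarrow> 'k" and t g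
begin

sublocale povm_approx M F t g ..

sublocale square: povm_approx M F "\<lambda>n w. (t n w)\<^sup>2" "\<lambda>w. (g w)\<^sup>2"
  by (intro povm_approx.intro povm_space_axioms square)

text \<open>As \<open>t\<close> increases, \<open>(t\<^sub>m - t\<^sub>n)\<^sup>2 \<le> t\<^sub>m\<^sup>2 - t\<^sub>n\<^sup>2\<close> for \<open>n \<le> m\<close>, so the Cauchy property reduces to convergence of the
  integrals of \<open>t\<^sub>n\<^sup>2\<close>.\<close>

lemma simple_op_converges:
  assumes "integrable (diagonal_measure M F x) (\<lambda>w. (g w)\<^sup>2)"
  obtains z where "(\<lambda>n. simple_op (t n) x) \<longlonglongrightarrow> z"
proof -
  let ?N = "diagonal_measure M F x"
  define I where "I n = (LINT w|?N. (t n w)\<^sup>2)" for n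
  have "\<forall>n. I n \<le> (LINT w|?N. (g w)\<^sup>2)"
    using square.integral_le[OF finite_diagonal sets_diagonal assms] by (simp add: I_def)
  then have "\<exists>C. \<forall>n. I n \<le> C" by blast
  from square.integrable_limit(2)[OF finite_diagonal sets_diagonal this[unfolded I_def]]
  have CI: "Cauchy I" unfolding I_def by (rule LIMSEQ_imp_Cauchy)
  have le: "(norm (simple_op (t m) x - simple_op (t n) x))\<^sup>2 \<le> I m - I n" if nm: "n \<le> m" for m n
  proof -
    have tm: "integrable ?N (\<lambda>w. (t k w)\<^sup>2)" for k
      by (rule square.integrable_simple[OF finite_diagonal sets_diagonal])
    have "(norm (simple_op (t m) x - simple_op (t n) x))\<^sup>2 = (LINT w|?N. (t m w - t n w)\<^sup>2)"
      using norm_simple_op[OF simple_function_diff[OF simple simple], of m n x]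
      by (simp add: simple_op_diff simple)
    also have "\<dots> \<le> (LINT w|?N. (t m w)\<^sup>2 - (t n w)\<^sup>2)"
    proof (rule integral_mono)
      show "integrable ?N (\<lambda>w. (t m w - t n w)\<^sup>2)"
        by (rule simple_function_integral(1)[OF finite_diagonal sets_diagonal
          simple_function_diff[OF simple simple], of _ "\<lambda>a. a\<^sup>2"])
      show "integrable ?N (\<lambda>w. (t m w)\<^sup>2 - (t n w)\<^sup>2)" using tm by auto
      show "(t m w - t n w)\<^sup>2 \<le> (t m w)\<^sup>2 - (t n w)\<^sup>2" for w
      proof -
        have "0 \<le> 2 * (t n w * (t m w - t n w))"
          using t_nonneg[of n w] incseqD[OF t_incseq nm, of w] by simp
        then show ?thesis by (simp add: power2_eq_square algebra_simps)
      qed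
    qed
    also have "\<dots> = I m - I n" using tm by (simp add: I_def)
    finally show ?thesis .
  qed
  have "Cauchy (\<lambda>n. simple_op (t n) x)"
  proof (rule Cauchy_of_square_norm)
    fix e :: real assume "0 < e"
    then obtain N where N: "\<And>m n. m \<ge> N \<Longrightarrow> n \<ge> N \<Longrightarrow> dist (I m) (I n) < e"
      using metric_CauchyD[OF CI] by blast
    have *: "(norm (simple_op (t m) x - simple_op (t n) x))\<^sup>2 < e" if "n \<ge> N" "n \<le> m" for m n
      using le[OF that(2)] N[of m n] that by (simp add: dist_real_def)
    show "\<exists>N. \<forall>m\<ge>N. \<forall>n\<ge>N. (norm (simple_op (t m) x - simple_op (t n) x))\<^sup>2 < e"
      using * by (metis norm_minus_commute nle_le)
  qed
  then show ?thesis using that Cauchy_convergent_iff convergent_def by blast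
qed

text \<open>Here \<open>y\<close> is an arbitrary vector, so the whole integrand is put on \<open>x\<close>: the bound is the mean of
  \<open>\<integral> 1 dF\<^bsub>y,y\<^esub>\<close> and \<open>\<integral> g\<^sup>2 dF\<^bsub>x,x\<^esub>\<close>.\<close>

lemma spectral_integral_limit:
  assumes \<phi>: "\<forall>w\<in>space M. \<phi> w = complex_of_real (g w)"
    and int: "integrable (diagonal_measure M F x) (\<lambda>w. (g w)\<^sup>2)"
    and z: "(\<lambda>n. simple_op (t n) x) \<longlonglongrightarrow> z"
  shows "cinner y z = integral_form M \<phi> F y x"
proof (rule LIMSEQ_unique)
  show "(\<lambda>n. cinner y (simple_op (t n) x)) \<longlonglongrightarrow> cinner y z"
    using z by (rule tendsto_cinner[OF tendsto_const])
  show "(\<lambda>n. cinner y (simple_op (t n) x)) \<longlonglongrightarrow> integral_form M \<phi> F y x"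
  proof (rule matrix_limit[OF \<phi>])
    fix c :: complex assume c: "cmod c = 1"
    have "(LINT w|positive_variation M (\<lambda>X. Re (c * cinner y (F X x))). t n w)
        \<le> ((LINT w|diagonal_measure M F y. 1\<^sup>2) + (LINT w|diagonal_measure M F x. (g w)\<^sup>2)) / 2" for n
    proof -
      have "(LINT w|positive_variation M (\<lambda>X. Re (c * cinner y (F X x))). t n w)
          \<le> ((LINT w|diagonal_measure M F y. 1\<^sup>2) + (LINT w|diagonal_measure M F x. (t n w)\<^sup>2)) / 2"
        by (rule positive_variation_integral_bound[OF simple c, where p = "\<lambda>a. 1" and r = "\<lambda>a. a"]) simp
      also have "\<dots> \<le> ((LINT w|diagonal_measure M F y. 1\<^sup>2) + (LINT w|diagonal_measure M F x. (g w)\<^sup>2)) / 2"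
        using square.integral_le[OF finite_diagonal sets_diagonal int, of n] by simp
      finally show ?thesis .
    qed
    then show "\<exists>C. \<forall>n. (LINT w|positive_variation M (\<lambda>X. Re (c * cinner y (F X x))). t n w) \<le> C"
      by blast
  qed
qed

lemma
  assumes \<phi>: "\<forall>w\<in>space M. \<phi> w = complex_of_real (g w)"
    and f: "\<forall>w\<in>space M. f w = complex_of_real ((g w)\<^sup>2)"
  shows dom_spectral_integral: "dom (spectral_integral M \<phi> F) = form_domain M f F"
    and cinner_spectral_integral: "\<And>x y. x \<in> form_domain M f F \<Longrightarrow> y \<in> form_domain M f F \<Longrightarrow>
      cinner (the (spectral_integral M \<phi> F x)) (the (spectral_integral M \<phi> F y)) = integral_form M f F x y"
proof -
  have cond: "(\<integral>\<^sup>+w. ennreal ((cmod (\<phi> w))\<^sup>2) \<partial>diagonal_measure M F x) < \<infinity> \<longleftrightarrow> x \<in> form_domain M f F" for x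
  proof -
    have "(\<integral>\<^sup>+w. ennreal ((cmod (\<phi> w))\<^sup>2) \<partial>diagonal_measure M F x)
        = (\<integral>\<^sup>+w. ennreal (cmod (f w)) \<partial>diagonal_measure M F x)"
      using \<phi> f by (intro nn_integral_cong) (simp add: norm_power)
    then show ?thesis by (simp add: form_domain_def)
  qed
  have "spectral_integral M \<phi> F x \<noteq> None \<longleftrightarrow> x \<in> form_domain M f F" for x
    unfolding spectral_integral_def cond by simp
  then show "dom (spectral_integral M \<phi> F) = form_domain M f F"
    by (simp add: dom_def)
  have lim: "(\<lambda>n. simple_op (t n) x) \<longlonglongrightarrow> the (spectral_integral M \<phi> F x)"
    if x: "x \<in> form_domain M f F" for x
  proof -
    have int: "integrable (diagonal_measure M F x) (\<lambda>w. (g w)\<^sup>2)"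
      using x square.form_domain_iff[OF f] by simp
    obtain z where z: "(\<lambda>n. simple_op (t n) x) \<longlonglongrightarrow> z" using int by (rule simple_op_converges)
    have rep: "cinner y z = integral_form M \<phi> F y x" for y
      using \<phi> int z by (rule spectral_integral_limit)
    have "(THE z. \<forall>y. cinner y z = integral_form M \<phi> F y x) = z"
    proof (rule the_equality)
      fix z' assume "\<forall>y. cinner y z' = integral_form M \<phi> F y x"
      then have "cinner y z' = cinner y z" for y using rep by simp
      then show "z' = z" by (rule cinner_dense_eq_right[OF closure_UNIV])
    qed (use rep in blast)
    then have "the (spectral_integral M \<phi> F x) = z"
      using x cond[of x] by (simp add: spectral_integral_def)
    with z show ?thesis by simp
  qed
  show "cinner (the (spectral_integral M \<phi> F x)) (the (spectral_integral M \<phi> F y)) = integral_form M f F x y"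
    if xy: "x \<in> form_domain M f F" "y \<in> form_domain M f F" for x y
  proof (rule LIMSEQ_unique)
    show "(\<lambda>n. cinner (simple_op (t n) x) (simple_op (t n) y))
        \<longlonglongrightarrow> cinner (the (spectral_integral M \<phi> F x)) (the (spectral_integral M \<phi> F y))"
      by (intro tendsto_cinner lim xy)
    show "(\<lambda>n. cinner (simple_op (t n) x) (simple_op (t n) y)) \<longlonglongrightarrow> integral_form M f F x y"
      using square.form_limit[OF f xy] by (simp add: simple_op_inner simple)
  qed
qed

end

section \<open>Naimark dilations\<close>

lemma naimark_dilation_cinner:
  fixes E :: "'w set \<Rightarrow> 'h::complex_inner \<Rightarrow> 'h" and F :: "'w set \<Rightarrow> 'k::complex_inner \<Rightarrow> 'k"
  assumes dil: "naimark_dilation M E F V" and X: "X \<in> sets M"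
  shows "cinner x (E X y) = cinner (V x) (F X (V y))"
proof -
  have "Some (E X y) = adjoint_operator (everywhere V) (F X (V y))"
  proof -
    have "everywhere (E X) = adjoint_operator (everywhere V) \<circ>\<^sub>m everywhere (F X) \<circ>\<^sub>m everywhere V"
      using dil X by (simp add: naimark_dilation_def)
    from fun_cong[OF this, of y] show ?thesis by (simp add: everywhere_def map_comp_def)
  qed
  moreover have "dom (everywhere V) = UNIV" by (auto simp: everywhere_def)
  ultimately have "cinner (F X (V y)) (V x) = cinner (E X y) x"
    using adjoint_operator_eq_Some[of "everywhere V" "F X (V y)" "E X y"] by (simp add: everywhere_def)
  then show ?thesis using cinner_commute by metis
qed

lemma integral_form_dilation:
  assumes "naimark_dilation M E F V"
  shows "integral_form M f E x y = integral_form M f F (V x) (V y)"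
proof -
  have "positive_variation M (\<lambda>X. h (cinner x (E X y))) = positive_variation M (\<lambda>X. h (cinner (V x) (F X (V y))))" for h
    by (rule positive_variation_cong) (simp add: naimark_dilation_cinner[OF assms])
  note * = this[of Re] this[of "\<lambda>z. - Re z"] this[of Im] this[of "\<lambda>z. - Im z"]
  show ?thesis unfolding integral_form_def cmeasure_integral_def * ..
qed

lemma form_domain_dilation:
  assumes "naimark_dilation M E F V"
  shows "form_domain M f E = {x. V x \<in> form_domain M f F}"
proof -
  have "diagonal_measure M E x = diagonal_measure M F (V x)" for x
    unfolding diagonal_measure_def
    by (rule measure_of_eq)
      (simp_all add: sets.space_closed sets.sigma_sets_eq naimark_dilation_cinner[OF assms])
  then show ?thesis by (simp add: form_domain_def)
qed

text \<open>The operator \<open>L(\<phi>, F) V\<close> has the domain and the form of \<open>f\<close> because \<open>E\<^bsub>x,y\<^esub> = F\<^bsub>V x,V y\<^esub>\<close>; the rest is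
  \<open>adjoint_comp_self\<close>.\<close>

lemma dilation_operator:
  fixes E :: "'w set \<Rightarrow> 'h::chilbert_space \<Rightarrow> 'h" and F :: "'w set \<Rightarrow> 'k::chilbert_space \<Rightarrow> 'k"
  assumes dil: "naimark_dilation M E F V" and t: "simple_approx M t g"
    and \<phi>: "\<forall>w\<in>space M. \<phi> w = complex_of_real (g w)"
    and f: "\<forall>w\<in>space M. f w = complex_of_real ((g w)\<^sup>2)"
  shows "adjoint_operator (spectral_integral M \<phi> F \<circ>\<^sub>m everywhere V)
      \<circ>\<^sub>m (spectral_integral M \<phi> F \<circ>\<^sub>m everywhere V)
    = form_op (form_domain M f E) (integral_form M f E)"
proof (rule adjoint_comp_self)
  have F: "povm M F" "\<And>X. X \<in> sets M \<Longrightarrow> F X \<circ> F X = F X"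
    using dil by (auto simp: naimark_dilation_def spectral_measure_def)
  interpret simple_approx M t g by fact
  interpret spectral_approx M F t g
    by unfold_locales (use F in \<open>auto simp: fun_eq_iff\<close>)
  have A: "(spectral_integral M \<phi> F \<circ>\<^sub>m everywhere V) x = spectral_integral M \<phi> F (V x)" for x
    by (simp add: everywhere_def map_comp_def)
  have D: "x \<in> form_domain M f E \<longleftrightarrow> V x \<in> form_domain M f F" for x
    using form_domain_dilation[OF dil] by simp
  show "dom (spectral_integral M \<phi> F \<circ>\<^sub>m everywhere V) = form_domain M f E"
    using dom_spectral_integral[OF \<phi> f] by (auto simp: A D dom_def)
  show "integral_form M f E x y = cinner (the ((spectral_integral M \<phi> F \<circ>\<^sub>m everywhere V) x))
      (the ((spectral_integral M \<phi> F \<circ>\<^sub>m everywhere V) y))"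
    if "x \<in> form_domain M f E" "y \<in> form_domain M f E" for x y
    using cinner_spectral_integral[OF \<phi> f, of "V x" "V y"] that
    by (simp add: A D integral_form_dilation[OF dil])
qed

section \<open>The form and operator of a positive integrand\<close>

theorem proposition15:
  fixes M :: "'w measure"
    and E :: "'w set \<Rightarrow> 'h::chilbert_space \<Rightarrow> 'h"
    and f :: "'w \<Rightarrow> complex"
  assumes "povm M E"
    and "f \<in> borel_measurable M"
    and "\<And>w. w \<in> space M \<Longrightarrow> f w \<in> \<real>\<^sub>\<ge>\<^sub>0"
    and "closure (form_domain M f E) = UNIV"
  shows "quadratic_form (form_domain M f E) (integral_form M f E) \<and>
    symmetric_form (form_domain M f E) (integral_form M f E) \<and>
    positive_form (form_domain M f E) (integral_form M f E) \<and>
    closed_form (form_domain M f E) (integral_form M f E) \<and>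
    (\<exists>!T. form_operator (form_domain M f E) (integral_form M f E) T) \<and>
    (\<forall>T. form_operator (form_domain M f E) (integral_form M f E) T \<longrightarrow>
      (\<forall>(F :: 'w set \<Rightarrow> 'k::chilbert_space \<Rightarrow> 'k) V. naimark_dilation M E F V \<longrightarrow>
        T = adjoint_operator (spectral_integral M (\<lambda>w. csqrt (f w)) F \<circ>\<^sub>m everywhere V)
              \<circ>\<^sub>m (spectral_integral M (\<lambda>w. csqrt (f w)) F \<circ>\<^sub>m everywhere V)) \<and>
      T = weak_integral M f E) \<and>
    selfadjoint_operator (weak_integral M f E)"
proof -
  let ?D = "form_domain M f E" and ?q = "integral_form M f E"
  define g where "g w = sqrt (Re (f w))" for w
  have f_eq: "f w = complex_of_real ((g w)\<^sup>2)"
    and csqrt_eq: "csqrt (f w) = complex_of_real (g w)" if "w \<in> space M" for w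
  proof -
    have nn: "0 \<le> Re (f w)" and im: "Im (f w) = 0"
      using assms(3)[OF that] by (simp_all add: complex_nonneg_Reals_iff)
    have sq: "(g w)\<^sup>2 = Re (f w)" using nn by (simp add: g_def)
    show "f w = complex_of_real ((g w)\<^sup>2)" using im by (simp only: sq) (simp add: complex_eq_iff)
    show "csqrt (f w) = complex_of_real (g w)"
      unfolding g_def using im nn by (rule csqrt_of_real_nonneg)
  qed
  have "g \<in> borel_measurable M" unfolding g_def using assms(2) by measurable
  moreover have "0 \<le> g w" if "w \<in> space M" for w
    using assms(3)[OF that] by (simp add: g_def complex_nonneg_Reals_iff)
  ultimately obtain t where t: "simple_approx M t g" by (rule simple_approx_exists)
  \<comment> \<open>A sequence approximating the square root of \<open>f\<close> serves the dilations, its squares serve the form.\<close>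
  interpret povm_approx M E "\<lambda>n w. (t n w)\<^sup>2" "\<lambda>w. (g w)\<^sup>2"
    using assms(1) t by (intro povm_approx.intro povm_space.intro simple_approx.square)
  interpret increasing_forms "\<lambda>n. simple_op (\<lambda>w. (t n w)\<^sup>2)" ?D ?q
    using f_eq by (intro increasing_forms) auto
  interpret closed_hermitian_form ?D ?q
    using hermitian closed assms(4) by (intro closed_hermitian_form.intro closed_hermitian_form_axioms.intro)
  have weak: "weak_integral M f E = form_op ?D ?q"
    unfolding form_op_eq_weak weak_integral_def ..
  have "adjoint_operator (spectral_integral M (\<lambda>w. csqrt (f w)) F \<circ>\<^sub>m everywhere V)
      \<circ>\<^sub>m (spectral_integral M (\<lambda>w. csqrt (f w)) F \<circ>\<^sub>m everywhere V) = form_op ?D ?q"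
    if "naimark_dilation M E F V" for F :: "'w set \<Rightarrow> 'k \<Rightarrow> 'k" and V
    using that t csqrt_eq f_eq by (intro dilation_operator) auto
  moreover have "quadratic_form ?D ?q"
    unfolding quadratic_form_def using subspace dense
    by (simp add: add_left add_right scale_left scale_right)
  moreover have "symmetric_form ?D ?q"
    unfolding symmetric_form_def using symmetric by blast
  moreover have "positive_form ?D ?q"
    unfolding positive_form_def using nonneg diagonal by (simp add: complex_nonneg_Reals_iff)
  ultimately show ?thesis
    unfolding form_operator_iff weak using closed selfadjoint_form_op by simp
qed

end
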